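(* Let $m=2$, $K\ge2$. For every fixed $M>0$ and every $s_2\in\{1,\dots,K-1\}$, with $\boldsymbol s=(K,s_2)$, it holds that $$\mathrm{PoisOPTRe}_K(\boldsymbol s)=\min_{\boldsymbol z\in\mathcal Z_{2,M}}\Theta_{K,s_2,M}(\boldsymbol z).$$
   Context: $\mathrm{Pois}(c)$ is a Poisson random variable of mean $c\ge0$; $\mathbf 1_E$ is the indicator of $E$. $P_K(c):=\Pr[\mathrm{Pois}(c)\le K-1]$ and $H_K(c):=\mathbb E[\min\{\mathrm{Pois}(c),K\}]$. **The problem $\mathrm{PoisOPTRe}_K(\boldsymbol s)$ for $m=2$**, with constant arrival rate $\lambda_t=M$ on $[0,1]$: the infimum of $\theta$ over $\theta\in\mathbb R$ and measurable functions $\alpha,\beta^1,\beta^2$ on $[0,1]$ with $0\le\beta^2_t\le\alpha_t\le\beta^1_t\le\lambda_t=M$, subject to $$\theta\ge\sum_{k=1}^Kx_1^k,\qquad \theta\,P_K\Big(\int_0^1\alpha_tdt\Big)\ge\sum_{k=s_2+1}^Kx_1^k,$$ $$\theta\,H_K\Big(\int_0^1\alpha_tdt\Big)\ge\sum_{k=1}^{s_2}\int_0^1\beta_t^2x_t^kdt+\sum_{k=s_2+1}^K\int_0^1\alpha_tx_t^kdt,$$ $$\theta\,H_K\Big(\int_0^1\lambda_tdt\Big)\ge\sum_{k=1}^{s_2}\int_0^1\beta_t^2x_t^kdt+\sum_{k=s_2+1}^K\int_0^1\beta_t^1x_t^kdt,$$ where $x_0^K=1$, $x_0^k=0$ for $k<K$,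 $\frac{dx_t^k}{dt}=-(y_t^k-y_t^{k+1})$ for $k\in\{1,\dots,K\}$, $y_t^k=\beta_t^1x_t^k$ for $k>s_2$, $y_t^k=\beta_t^2x_t^k$ for $1\le k\le s_2$, $y_t^{K+1}=0$. **The finite-dimensional problem.** $$\mathcal Z_{2,M}:=\{(S,a,b,\Lambda_1):0\le a\le b\le S\le M,\ b-a\le\Lambda_1\le S\}.$$ For $\boldsymbol z=(S,a,b,\Lambda_1)\in\mathcal Z_{2,M}$ and $t\in[0,S/M]$ let $\beta^2_{\boldsymbol z}(t):=M\,\mathbf 1_{[a/M,b/M]}(t)$ and $$\alpha_{\boldsymbol z}(t):=\begin{cases}M\,\mathbf 1_{[\frac{S-\Lambda_1}{M},\frac SM]}(t),&S-\Lambda_1\le a,\\ M\,\mathbf 1_{[\frac aM,\frac bM]\cup[\frac{S-\Lambda_1+b-a}{M},\frac SM]}(t),&S-\Lambda_1>a.\end{cases}$$ Let $x^{k,\boldsymbol z}_t$, $t\in[0,S/M]$, solve $\frac{d}{dt}x_t^{k,\boldsymbol z}=-r_k^{\boldsymbol z}(t)x_t^{k,\boldsymbol z}+r_{k+1}^{\boldsymbol z}(t)x_t^{k+1,\boldsymbol z}$, $k=1,\dots,K$, with $x_0^{K,\boldsymbol z}=1$, $x_0^{k,\boldsymbol z}=0$ for $k<K$, $r_k^{\boldsymbol z}(t)=\beta^2_{\boldsymbol z}(t)$ for $1\le k\le s_2$, $r_k^{\boldsymbol z}(t)=M$ for $s_2<k\le K$, and $r_{K+1}^{\boldsymbol z}=x^{K+1,\boldsymbol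 z}=0$. Define $$\mathcal R_1(\boldsymbol z)=\sum_{k=1}^Kx_{S/M}^{k,\boldsymbol z},\qquad \mathcal R_2(\boldsymbol z)=\sum_{k=s_2+1}^Kx_{S/M}^{k,\boldsymbol z},$$ $$\mathcal R_3(\boldsymbol z)=\int_0^{S/M}\Big[\beta^2_{\boldsymbol z}(t)\sum_{k=1}^{s_2}x_t^{k,\boldsymbol z}+\alpha_{\boldsymbol z}(t)\sum_{k=s_2+1}^Kx_t^{k,\boldsymbol z}\Big]dt,$$ $$\mathcal R_4(\boldsymbol z)=\int_0^{S/M}\Big[\beta^2_{\boldsymbol z}(t)\sum_{k=1}^{s_2}x_t^{k,\boldsymbol z}+M\sum_{k=s_2+1}^Kx_t^{k,\boldsymbol z}\Big]dt,$$ $$\Theta_{K,s_2,M}(\boldsymbol z):=\max\Big\{\mathcal R_1(\boldsymbol z),\frac{\mathcal R_2(\boldsymbol z)}{P_K(\Lambda_1)},\frac{\mathcal R_3(\boldsymbol z)}{H_K(\Lambda_1)},\frac{\mathcal R_4(\boldsymbol z)}{H_K(M)}\Big\},$$ where $\mathcal R_3(\boldsymbol z)/H_K(\Lambda_1)$ is interpreted as $0$ when $\Lambda_1=0$ (in which case $\mathcal R_3(\boldsymbol z)=0$). *)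

theory Defs
  imports "HOL-Probability.Probability"
begin

text \<open>The library's \<open>poisson_pmf\<close> is only meaningful for positive rates; mean \<open>0\<close> is the
  point mass at \<open>0\<close>.\<close>

definition Pois :: "real \<Rightarrow> nat pmf" where
  "Pois c = (if c > 0 then poisson_pmf c else return_pmf 0)"

definition P :: "nat \<Rightarrow> real \<Rightarrow> real" where
  "P K c = measure_pmf.prob (Pois c) {n. n \<le> K - 1}"

definition H :: "nat \<Rightarrow> real \<Rightarrow> real" where
  "H K c = measure_pmf.expectation (Pois c) (\<lambda>n. real (min n K))"

definition flow ::
  "nat \<Rightarrow> nat \<Rightarrow> (real \<Rightarrow> real) \<Rightarrow> (real \<Rightarrow> real) \<Rightarrow> (nat \<Rightarrow> real \<Rightarrow> real) \<Rightarrow> nat \<Rightarrow> real \<Rightarrow> real" where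
  "flow K s2 \<beta>1 \<beta>2 x k t =
     (if k \<le> s2 then \<beta>2 t * x k t else if k \<le> K then \<beta>1 t * x k t else 0)"

text \<open>\<open>x\<close> solves \<open>dx\<^sup>k/dt = - (y\<^sup>k - y\<^sup>k\<^sup>+\<^sup>1)\<close> on \<open>[0, T]\<close>, where \<open>y\<close> is the flow above and
  \<open>x\<^sup>K\<^sub>0 = 1\<close>, \<open>x\<^sup>k\<^sub>0 = 0\<close> for \<open>k < K\<close>. The rates are merely measurable (for the finite-dimensional
  problem, discontinuous), so the equation is read in the sense of Caratheodory: \<open>x\<close> is
  continuous and satisfies the integrated equation.\<close>

definition is_solution ::
  "nat \<Rightarrow> nat \<Rightarrow> real \<Rightarrow> (real \<Rightarrow> real) \<Rightarrow> (real \<Rightarrow> real) \<Rightarrow> (nat \<Rightarrow> real \<Rightarrow> real) \<Rightarrow> bool" where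
  "is_solution K s2 T \<beta>1 \<beta>2 x \<longleftrightarrow>
     (\<forall>k\<in>{1..K}. continuous_on {0..T} (x k) \<and>
        (\<forall>t\<in>{0..T}. x k t = (if k = K then 1 else 0) +
           (LINT u:{0..t}|lebesgue.
              - (flow K s2 \<beta>1 \<beta>2 x k u - flow K s2 \<beta>1 \<beta>2 x (k + 1) u))))"

text \<open>Feasibility for arrival rate \<open>lam\<close>; the first component of \<open>s = (K, s2)\<close> is always \<open>K\<close> and
  therefore not a separate parameter.\<close>

definition feasible ::
  "nat \<Rightarrow> nat \<Rightarrow> (real \<Rightarrow> real) \<Rightarrow> real \<Rightarrow> (real \<Rightarrow> real) \<Rightarrow> (real \<Rightarrow> real) \<Rightarrow> (real \<Rightarrow> real) \<Rightarrow> bool"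
where
  "feasible K s2 lam \<theta> \<alpha> \<beta>1 \<beta>2 \<longleftrightarrow>
     \<alpha> \<in> borel_measurable (lebesgue_on {0..1}) \<and>
     \<beta>1 \<in> borel_measurable (lebesgue_on {0..1}) \<and>
     \<beta>2 \<in> borel_measurable (lebesgue_on {0..1}) \<and>
     (\<forall>t\<in>{0..1}. 0 \<le> \<beta>2 t \<and> \<beta>2 t \<le> \<alpha> t \<and> \<alpha> t \<le> \<beta>1 t \<and> \<beta>1 t \<le> lam t) \<and>
     (\<exists>x. is_solution K s2 1 \<beta>1 \<beta>2 x \<and>
        \<theta> \<ge> (\<Sum>k=1..K. x k 1) \<and>
        \<theta> * P K (LINT t:{0..1}|lebesgue. \<alpha> t) \<ge> (\<Sum>k=s2+1..K. x k 1) \<and>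
        \<theta> * H K (LINT t:{0..1}|lebesgue. \<alpha> t) \<ge>
          (\<Sum>k=1..s2. LINT t:{0..1}|lebesgue. \<beta>2 t * x k t) +
          (\<Sum>k=s2+1..K. LINT t:{0..1}|lebesgue. \<alpha> t * x k t) \<and>
        \<theta> * H K (LINT t:{0..1}|lebesgue. lam t) \<ge>
          (\<Sum>k=1..s2. LINT t:{0..1}|lebesgue. \<beta>2 t * x k t) +
          (\<Sum>k=s2+1..K. LINT t:{0..1}|lebesgue. \<beta>1 t * x k t))"

text \<open>The infimum is taken in the extended reals, where it is the genuine one without any side
  condition on nonemptiness or boundedness.\<close>

definition PoisOPTRe :: "nat \<Rightarrow> nat \<Rightarrow> (real \<Rightarrow> real) \<Rightarrow> ereal" where
  "PoisOPTRe K s2 lam = Inf {ereal \<theta> |\<theta>. \<exists>\<alpha> \<beta>1 \<beta>2. feasible K s2 lam \<theta> \<alpha> \<beta>1 \<beta>2}"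

type_synonym params = "real \<times> real \<times> real \<times> real"

definition Z2 :: "real \<Rightarrow> params set" where
  "Z2 M = {(S, a, b, \<Lambda>1). 0 \<le> a \<and> a \<le> b \<and> b \<le> S \<and> S \<le> M \<and> b - a \<le> \<Lambda>1 \<and> \<Lambda>1 \<le> S}"

fun beta2z :: "real \<Rightarrow> params \<Rightarrow> real \<Rightarrow> real" where
  "beta2z M (S, a, b, \<Lambda>1) t = M * indicator {a/M..b/M} t"

fun alphaz :: "real \<Rightarrow> params \<Rightarrow> real \<Rightarrow> real" where
  "alphaz M (S, a, b, \<Lambda>1) t =
     (if S - \<Lambda>1 \<le> a then M * indicator {(S - \<Lambda>1)/M..S/M} t
      else M * indicator ({a/M..b/M} \<union> {(S - \<Lambda>1 + b - a)/M..S/M}) t)"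

fun horizon :: "real \<Rightarrow> params \<Rightarrow> real" where
  "horizon M (S, a, b, \<Lambda>1) = S / M"

text \<open>The choice is harmless: the solution exists, and the components \<open>1..K\<close> are unique on
  \<open>[0, S/M]\<close>; only these values are used.\<close>

definition xz :: "nat \<Rightarrow> nat \<Rightarrow> real \<Rightarrow> params \<Rightarrow> nat \<Rightarrow> real \<Rightarrow> real" where
  "xz K s2 M z = (SOME x. is_solution K s2 (horizon M z) (\<lambda>_. M) (beta2z M z) x)"

definition R1 :: "nat \<Rightarrow> nat \<Rightarrow> real \<Rightarrow> params \<Rightarrow> real" where
  "R1 K s2 M z = (\<Sum>k=1..K. xz K s2 M z k (horizon M z))"

definition R2 :: "nat \<Rightarrow> nat \<Rightarrow> real \<Rightarrow> params \<Rightarrow> real" where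
  "R2 K s2 M z = (\<Sum>k=s2+1..K. xz K s2 M z k (horizon M z))"

definition R3 :: "nat \<Rightarrow> nat \<Rightarrow> real \<Rightarrow> params \<Rightarrow> real" where
  "R3 K s2 M z = (LINT t:{0..horizon M z}|lebesgue.
     beta2z M z t * (\<Sum>k=1..s2. xz K s2 M z k t) +
     alphaz M z t * (\<Sum>k=s2+1..K. xz K s2 M z k t))"

definition R4 :: "nat \<Rightarrow> nat \<Rightarrow> real \<Rightarrow> params \<Rightarrow> real" where
  "R4 K s2 M z = (LINT t:{0..horizon M z}|lebesgue.
     beta2z M z t * (\<Sum>k=1..s2. xz K s2 M z k t) +
     M * (\<Sum>k=s2+1..K. xz K s2 M z k t))"

text \<open>For \<open>\<Lambda>1 = 0\<close> the third quotient has denominator \<open>H K 0 = 0\<close>; its value in HOL is then \<open>0\<close>,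
  which is the intended convention.\<close>

definition Theta :: "nat \<Rightarrow> nat \<Rightarrow> real \<Rightarrow> params \<Rightarrow> real" where
  "Theta K s2 M z = (case z of (S, a, b, \<Lambda>1) \<Rightarrow>
     Max {R1 K s2 M z, R2 K s2 M z / P K \<Lambda>1, R3 K s2 M z / H K \<Lambda>1, R4 K s2 M z / H K M})"

end

theory Submission
  imports Defs
begin

text \<open>Let \<open>\<sigma>(t)\<close>, \<open>V(t)\<close> and \<open>A(t)\<close> be the integrals of \<open>\<beta>1\<close>, \<open>\<beta>2\<close> and \<open>\<alpha>\<close> over \<open>[0, t]\<close>; the first two act as
  clocks. The system is the Kolmogorov equation of a pure death chain started in \<open>K\<close>: it leaves an
  upper state \<open>k > s2\<close> at rate \<open>\<beta>1\<close> and a lower state \<open>1 \<le> k \<le> s2\<close> at rate \<open>\<beta>2\<close>. The upper block is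
  therefore a Poisson process run by \<open>\<sigma>\<close>, and mass enters the lower block at rate
  \<open>\<beta>1 pois (K - s2 - 1) \<sigma>\<close>. Mass that enters at time \<open>t\<close> still has the \<open>\<beta>2\<close>-clock
  \<open>G(t) = V(T) - V(t)\<close> in front of it, so it survives to the horizon \<open>T\<close> with probability \<open>Q(G(t))\<close>,
  \<open>Q(c) = Pr[Pois(c) < s2]\<close>, and makes \<open>h(G(t))\<close> jumps on average, \<open>h(c) = E[min(Pois(c), s2)]\<close>.
  An integration by parts for the upper block shows that all four right-hand sides of the problem
  depend on the policy only through \<open>\<sigma>(T)\<close> and the integrals of \<open>Q(G)\<close>, \<open>h(G)\<close> and
  \<open>D(t) = A(T) - A(t)\<close> against the entrance rate, together with \<open>A(T)\<close> (lemmas \<open>alive_eq\<close>,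
  \<open>service_eq\<close>). These identities are obtained for any solution by pairing it with solutions of the
  backward equation (lemma \<open>lower_duality\<close>).

  An arbitrary policy is beaten by an interval policy with the same \<open>S = \<sigma>(T)\<close>, \<open>B = V(T)\<close> and
  \<open>\<Lambda> = A(T)\<close> (lemma \<open>interval_policy_dominates\<close>). In the time scale \<open>s = \<sigma>(t)\<close> the policy that serves
  the lower block exactly on \<open>[a, a + B]\<close> has \<open>G*(s) = min B (max 0 (a + B - s))\<close>. Choose \<open>a\<close> by the
  intermediate value theorem so that the integral of \<open>h(G)\<close> is unchanged. Since \<open>G*\<close> is first
  constant, then has slope \<open>-1\<close> until it vanishes, and \<open>G\<close> is 1-Lipschitz in \<open>s\<close>, the difference \<open>G* - G\<close> changes sign
  only once, from plus to minus, while \<open>G\<close> is decreasing. The hazard ratio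
  \<open>pois (s2 - 1) c / Q(c)\<close> is nondecreasing in \<open>c\<close>, that is, \<open>1 - Q\<close> is a convex function of \<open>h\<close>; so is the
  identity, as \<open>Q\<close> decreases. Single crossing thus raises the integrals of \<open>1 - Q(G)\<close> and of \<open>G\<close>
  (lemma \<open>relative_convex_increment\<close>): fewer survivors, and more room for postponing \<open>\<alpha>\<close>.
  Indeed \<open>D \<le> min (S - s) (\<Lambda> - B + G)\<close> for every admissible \<open>\<alpha>\<close>, and \<open>alphaz\<close> attains this bound for
  \<open>G*\<close>; a large \<open>D\<close> makes the third constraint easier.

  For an interval policy the four values are explicit continuous functions of \<open>z\<close> on the compact set
  \<open>Z2 M\<close>. The objective \<open>Theta\<close> itself may jump at \<open>\<Lambda>1 = 0\<close>, where a quotient is declared to be \<open>0\<close>;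
  the inequalities without quotients (\<open>certified\<close>) are continuous and equivalent to \<open>Theta z \<le> \<theta>\<close>,
  so the minimum is attained by minimising \<open>\<theta>\<close> over a compact set of pairs \<open>(z, \<theta>)\<close>.\<close>

section \<open>Bounded measurable functions and their primitives\<close>

definition bdd_meas :: "real \<Rightarrow> (real \<Rightarrow> real) \<Rightarrow> bool" where
  "bdd_meas T f \<longleftrightarrow>
     f \<in> borel_measurable (lebesgue_on {0..T}) \<and> (\<exists>C. \<forall>t\<in>{0..T}. \<bar>f t\<bar> \<le> C)"

lemma bdd_measI:
  assumes "f \<in> borel_measurable (lebesgue_on {0..T})" "\<And>t. t \<in> {0..T} \<Longrightarrow> \<bar>f t\<bar> \<le> C"
  shows "bdd_meas T f"
  using assms unfolding bdd_meas_def by blast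

lemma bdd_meas_continuous:
  assumes "continuous_on {0..T} f"
  shows "bdd_meas T f"
proof -
  have "f \<in> borel_measurable (lebesgue_on {0..T})"
    using assms by (intro continuous_imp_measurable_on_sets_lebesgue) auto
  moreover have "bounded (f ` {0..T})"
    using assms by (intro compact_imp_bounded compact_continuous_image) auto
  ultimately show ?thesis
    unfolding bdd_meas_def bounded_iff by auto
qed

lemma bdd_meas_cong:
  assumes "\<And>t. t \<in> {0..T} \<Longrightarrow> f t = g t" "bdd_meas T f"
  shows "bdd_meas T g"
proof -
  have "g \<in> borel_measurable (lebesgue_on {0..T})"
    using assms measurable_cong[of "lebesgue_on {0..T}" f g borel]
    unfolding bdd_meas_def by auto
  then show ?thesis
    using assms unfolding bdd_meas_def by auto
qed

lemma bdd_meas_const: "bdd_meas T (\<lambda>_. c)"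
  unfolding bdd_meas_def by auto

lemma bdd_meas_add:
  assumes "bdd_meas T f" "bdd_meas T g"
  shows "bdd_meas T (\<lambda>t. f t + g t)"
proof -
  obtain C D where "\<forall>t\<in>{0..T}. \<bar>f t\<bar> \<le> C" "\<forall>t\<in>{0..T}. \<bar>g t\<bar> \<le> D"
    using assms unfolding bdd_meas_def by auto
  then have "\<bar>f t + g t\<bar> \<le> C + D" if "t \<in> {0..T}" for t
    using that by (smt (verit))
  then show ?thesis
    using assms unfolding bdd_meas_def by (auto intro!: borel_measurable_add exI[of _ "C + D"])
qed

lemma bdd_meas_mult:
  assumes "bdd_meas T f" "bdd_meas T g"
  shows "bdd_meas T (\<lambda>t. f t * g t)"
proof -
  obtain C D where "\<forall>t\<in>{0..T}. \<bar>f t\<bar> \<le> C" "\<forall>t\<in>{0..T}. \<bar>g t\<bar> \<le> D"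
    using assms unfolding bdd_meas_def by auto
  then have "\<bar>f t\<bar> * \<bar>g t\<bar> \<le> C * D" if "t \<in> {0..T}" for t
    using that abs_ge_zero[of "f t"] by (intro mult_mono) (auto intro: order_trans)
  then have "\<bar>f t * g t\<bar> \<le> C * D" if "t \<in> {0..T}" for t
    using that by (simp add: abs_mult)
  then show ?thesis
    using assms unfolding bdd_meas_def by (auto intro!: borel_measurable_times exI[of _ "C * D"])
qed

lemma bdd_meas_uminus: "bdd_meas T f \<Longrightarrow> bdd_meas T (\<lambda>t. - f t)"
  using bdd_meas_mult[OF bdd_meas_const[of T "-1"]] by simp

lemma bdd_meas_diff:
  "bdd_meas T f \<Longrightarrow> bdd_meas T g \<Longrightarrow> bdd_meas T (\<lambda>t. f t - g t)"
  using bdd_meas_add[OF _ bdd_meas_uminus] by simp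

lemma bdd_meas_sum:
  "(\<And>i. i \<in> I \<Longrightarrow> bdd_meas T (f i)) \<Longrightarrow> bdd_meas T (\<lambda>t. \<Sum>i\<in>I. f i t)"
  by (induction I rule: infinite_finite_induct) (auto intro!: bdd_meas_const bdd_meas_add)

lemma bdd_meas_absolutely_integrable:
  assumes "bdd_meas T f" "0 \<le> a" "b \<le> T"
  shows "f absolutely_integrable_on {a..b}"
proof -
  obtain C where C: "\<forall>t\<in>{0..T}. \<bar>f t\<bar> \<le> C"
    using assms unfolding bdd_meas_def by auto
  have sub: "{a..b} \<subseteq> {0..T}"
    using assms by auto
  have "f \<in> borel_measurable (lebesgue_on {0..T})"
    using assms unfolding bdd_meas_def by auto
  then have "f \<in> borel_measurable (lebesgue_on {a..b})"
    using sub measurable_restrict_mono by blast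
  then show ?thesis
    using C sub
    by (intro measurable_bounded_by_integrable_imp_absolutely_integrable[where g = "\<lambda>_. C"])
       auto
qed

lemma bdd_meas_integrable:
  "bdd_meas T f \<Longrightarrow> 0 \<le> a \<Longrightarrow> b \<le> T \<Longrightarrow> f integrable_on {a..b}"
  using bdd_meas_absolutely_integrable set_lebesgue_integral_eq_integral(1) by blast

lemma bdd_meas_set_integral:
  "bdd_meas T f \<Longrightarrow> 0 \<le> a \<Longrightarrow> b \<le> T \<Longrightarrow> (LINT t:{a..b}|lebesgue. f t) = integral {a..b} f"
  using bdd_meas_absolutely_integrable set_lebesgue_integral_eq_integral(2) by blast

lemma integral_add_on:
  assumes "bdd_meas T f" "bdd_meas T g" "t \<in> {0..T}"
  shows "integral {0..t} (\<lambda>u. f u + g u) = integral {0..t} f + integral {0..t} g"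
  using assms by (intro Henstock_Kurzweil_Integration.integral_add bdd_meas_integrable[where T = T]) auto

lemma integral_diff_on:
  assumes "bdd_meas T f" "bdd_meas T g" "t \<in> {0..T}"
  shows "integral {0..t} (\<lambda>u. f u - g u) = integral {0..t} f - integral {0..t} g"
  using assms by (intro Henstock_Kurzweil_Integration.integral_diff bdd_meas_integrable[where T = T]) auto

text \<open>The rates are only measurable, so the solutions are differentiable merely almost everywhere.
  All calculus below concerns functions that are integrals of bounded measurable functions.\<close>

definition primitive :: "real \<Rightarrow> (real \<Rightarrow> real) \<Rightarrow> (real \<Rightarrow> real) \<Rightarrow> bool" where
  "primitive T F f \<longleftrightarrow>
     bdd_meas T f \<and> (\<forall>t\<in>{0..T}. F t - F 0 = integral {0..t} f)"

lemma primitive_increment: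
  assumes "primitive T F f" "0 \<le> s" "s \<le> t" "t \<le> T"
  shows "F t - F s = integral {s..t} f"
proof -
  have "integral {0..s} f + integral {s..t} f = integral {0..t} f"
    using assms unfolding primitive_def
    by (intro Henstock_Kurzweil_Integration.integral_combine bdd_meas_integrable[where T = T]) auto
  moreover have "F t - F 0 = integral {0..t} f" "F s - F 0 = integral {0..s} f"
    using assms unfolding primitive_def by auto
  ultimately show ?thesis by simp
qed

lemma primitive_integral:
  "bdd_meas T f \<Longrightarrow> primitive T (\<lambda>t. integral {0..t} f) f"
  unfolding primitive_def by simp

lemma primitive_bdd_meas: "primitive T F f \<Longrightarrow> bdd_meas T f"
  unfolding primitive_def by simp

lemma integral_abs_le_const:
  fixes f :: "real \<Rightarrow> real"
  assumes "f integrable_on {a..b}" "a \<le> b" "\<And>t. t \<in> {a..b} \<Longrightarrow> \<bar>f t\<bar> \<le> C"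
  shows "\<bar>integral {a..b} f\<bar> \<le> C * (b - a)"
proof -
  have "norm (integral {a..b} f) \<le> integral {a..b} (\<lambda>_. C)"
    using assms by (intro integral_norm_bound_integral) auto
  then show ?thesis
    using assms by (simp add: mult.commute)
qed

lemma primitive_lipschitz:
  assumes "primitive T F f"
  obtains C where "C > 0" "\<And>s t. s \<in> {0..T} \<Longrightarrow> t \<in> {0..T} \<Longrightarrow> \<bar>F t - F s\<bar> \<le> C * \<bar>t - s\<bar>"
    "\<And>t. t \<in> {0..T} \<Longrightarrow> \<bar>f t\<bar> \<le> C"
proof -
  have bm: "bdd_meas T f"
    using assms primitive_bdd_meas by blast
  obtain C0 where C0: "\<forall>t\<in>{0..T}. \<bar>f t\<bar> \<le> C0"
    using bm unfolding bdd_meas_def by auto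
  define C where "C = \<bar>C0\<bar> + 1"
  have C: "\<bar>f t\<bar> \<le> C" if "t \<in> {0..T}" for t
    using C0 that unfolding C_def by (smt (verit))
  have *: "\<bar>F t - F s\<bar> \<le> C * (t - s)" if "0 \<le> s" "s \<le> t" "t \<le> T" for s t
    unfolding primitive_increment[OF assms that]
    using that C by (intro integral_abs_le_const bdd_meas_integrable[OF bm]) auto
  have "\<bar>F t - F s\<bar> \<le> C * \<bar>t - s\<bar>" if "s \<in> {0..T}" "t \<in> {0..T}" for s t
    using *[of s t] *[of t s] that by (cases "s \<le> t") (auto simp: abs_minus_commute)
  then show ?thesis
    using C by (intro that[of C]) (auto simp: C_def)
qed

lemma primitive_continuous:
  assumes "primitive T F f"
  shows "continuous_on {0..T} F"
proof -
  obtain C where C: "C > 0" "\<And>s t. s \<in> {0..T} \<Longrightarrow> t \<in> {0..T} \<Longrightarrow> \<bar>F t - F s\<bar> \<le> C * \<bar>t - s\<bar>"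
    using primitive_lipschitz[OF assms] by metis
  show ?thesis
  proof (rule lipschitz_on_continuous_on)
    show "C-lipschitz_on {0..T} F"
      using C by (intro lipschitz_onI) (auto simp: dist_real_def)
  qed
qed

lemma primitive_cong:
  assumes "primitive T F f" "\<And>t. t \<in> {0..T} \<Longrightarrow> F t = G t" "\<And>t. t \<in> {0..T} \<Longrightarrow> f t = g t"
  shows "primitive T G g"
proof -
  have "G t - G 0 = integral {0..t} g" if "t \<in> {0..T}" for t
  proof -
    have "integral {0..t} f = integral {0..t} g"
      using that assms by (intro Henstock_Kurzweil_Integration.integral_cong) auto
    moreover have "F t = G t" "F 0 = G 0"
      using that assms(2) by auto
    moreover have "F t - F 0 = integral {0..t} f"
      using assms(1) that unfolding primitive_def by blast
    ultimately show ?thesis by simp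
  qed
  then show ?thesis
    using assms bdd_meas_cong[of T f g] unfolding primitive_def by blast
qed

lemma primitive_const: "primitive T (\<lambda>_. c) (\<lambda>_. 0)"
  unfolding primitive_def by (simp add: bdd_meas_const)

lemma primitive_add:
  assumes "primitive T F f" "primitive T G g"
  shows "primitive T (\<lambda>t. F t + G t) (\<lambda>t. f t + g t)"
  unfolding primitive_def
proof (intro conjI ballI)
  fix t assume t: "t \<in> {0..T}"
  have "F t - F 0 = integral {0..t} f" "G t - G 0 = integral {0..t} g"
    using assms t unfolding primitive_def by blast+
  moreover have "integral {0..t} (\<lambda>u. f u + g u) = integral {0..t} f + integral {0..t} g"
    using assms t by (intro integral_add_on primitive_bdd_meas)
  ultimately show "F t + G t - (F 0 + G 0) = integral {0..t} (\<lambda>u. f u + g u)"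
    by linarith
qed (intro bdd_meas_add primitive_bdd_meas[OF assms(1)] primitive_bdd_meas[OF assms(2)])

lemma primitive_cmult:
  assumes "primitive T F f"
  shows "primitive T (\<lambda>t. c * F t) (\<lambda>t. c * f t)"
  unfolding primitive_def
proof (intro conjI ballI)
  fix t assume "t \<in> {0..T}"
  then have "F t - F 0 = integral {0..t} f"
    using assms unfolding primitive_def by blast
  then show "c * F t - c * F 0 = integral {0..t} (\<lambda>u. c * f u)"
    by (simp only: Henstock_Kurzweil_Integration.integral_mult_right right_diff_distrib[symmetric])
qed (intro bdd_meas_mult bdd_meas_const primitive_bdd_meas[OF assms])

lemma primitive_diff:
  assumes "primitive T F f" "primitive T G g"
  shows "primitive T (\<lambda>t. F t - G t) (\<lambda>t. f t - g t)"
  using primitive_add[OF assms(1) primitive_cmult[OF assms(2), of "-1"]] by simp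

lemma primitive_sum:
  "(\<And>i. i \<in> I \<Longrightarrow> primitive T (F i) (f i)) \<Longrightarrow>
     primitive T (\<lambda>t. \<Sum>i\<in>I. F i t) (\<lambda>t. \<Sum>i\<in>I. f i t)"
  by (induction I rule: infinite_finite_induct) (auto intro!: primitive_const primitive_add)

text \<open>The difference between \<open>\<phi> \<circ> F\<close> and the integral of \<open>(\<phi>' \<circ> F) f\<close> has derivative \<open>0\<close> at every
  point, although neither function need be differentiable there: near \<open>s\<close> both increments are
  \<open>\<phi>' (F s)\<close> times the increment of \<open>F\<close>, up to an error that is small compared to \<open>t - s\<close>.\<close>

lemma primitive_chain:
  assumes F: "primitive T F f"
    and range: "\<And>t. t \<in> {0..T} \<Longrightarrow> F t \<in> X"
    and deriv: "\<And>y. y \<in> X \<Longrightarrow> (\<phi> has_real_derivative \<phi>' y) (at y within X)"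
    and cont: "continuous_on X \<phi>'"
  shows "primitive T (\<lambda>t. \<phi> (F t)) (\<lambda>t. \<phi>' (F t) * f t)"
proof -
  obtain C where C: "C > 0" "\<And>s t. s \<in> {0..T} \<Longrightarrow> t \<in> {0..T} \<Longrightarrow> \<bar>F t - F s\<bar> \<le> C * \<bar>t - s\<bar>"
    "\<And>t. t \<in> {0..T} \<Longrightarrow> \<bar>f t\<bar> \<le> C"
    using primitive_lipschitz[OF F] by metis
  have contF: "continuous_on {0..T} F"
    using F primitive_continuous by blast
  have cont\<phi>': "continuous_on {0..T} (\<lambda>t. \<phi>' (F t))"
    using range by (intro continuous_on_compose2[OF cont contF]) auto
  define g where "g = (\<lambda>t. \<phi>' (F t) * f t)"
  have bf: "bdd_meas T f"
    using F primitive_bdd_meas by blast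
  have bg: "bdd_meas T g"
    unfolding g_def by (intro bdd_meas_mult bdd_meas_continuous cont\<phi>' bf)
  define \<Psi> where "\<Psi> t = \<phi> (F t) - integral {0..t} g" for t
  have "(\<Psi> has_field_derivative 0) (at s within {0..T})" if s: "s \<in> {0..T}" for s
    unfolding has_field_derivative_def has_derivative_within_alt
  proof (intro conjI allI impI)
    show "bounded_linear ((*) (0::real))"
      by (rule bounded_linear_mult_right)
    fix e :: real assume e: "e > 0"
    define e' where "e' = e / (2 * C)"
    have e': "e' > 0" "e' * C = e / 2"
      using e C by (auto simp: e'_def)
    from deriv[OF range[OF s]] obtain d1 where d1: "d1 > 0"
      "\<And>y. y \<in> X \<Longrightarrow> \<bar>y - F s\<bar> < d1 \<Longrightarrow>
         \<bar>\<phi> y - \<phi> (F s) - \<phi>' (F s) * (y - F s)\<bar> \<le> e' * \<bar>y - F s\<bar>"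
      unfolding has_field_derivative_def has_derivative_within_alt
      using e' by (metis real_norm_def)
    obtain d2 where d2: "d2 > 0"
      "\<And>u. u \<in> {0..T} \<Longrightarrow> \<bar>u - s\<bar> < d2 \<Longrightarrow> \<bar>\<phi>' (F u) - \<phi>' (F s)\<bar> < e'"
      using cont\<phi>' s e' unfolding continuous_on_iff dist_real_def by metis
    define d where "d = min (d1 / C) d2"
    have "d > 0"
      using d1 d2 C by (auto simp: d_def)
    moreover have "norm (\<Psi> t - \<Psi> s - 0 * (t - s)) \<le> e * norm (t - s)"
      if t: "t \<in> {0..T}" "norm (t - s) < d" for t
    proof -
      have dd: "\<bar>t - s\<bar> < d1 / C" "\<bar>t - s\<bar> < d2"
        using t by (auto simp: d_def)
      have "\<bar>F t - F s\<bar> \<le> C * \<bar>t - s\<bar>"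
        using C s t by blast
      moreover from dd have "C * \<bar>t - s\<bar> < d1"
        using C by (simp add: pos_less_divide_eq mult.commute)
      ultimately have Fd: "\<bar>F t - F s\<bar> < d1"
        by linarith
      have 1: "\<bar>\<phi> (F t) - \<phi> (F s) - \<phi>' (F s) * (F t - F s)\<bar> \<le> e / 2 * \<bar>t - s\<bar>"
      proof -
        have "\<bar>\<phi> (F t) - \<phi> (F s) - \<phi>' (F s) * (F t - F s)\<bar> \<le> e' * \<bar>F t - F s\<bar>"
          using d1(2)[OF range[OF t(1)] Fd] .
        also have "\<dots> \<le> e' * (C * \<bar>t - s\<bar>)"
          using C s t e' by (intro mult_left_mono) auto
        finally show ?thesis using e' by (simp add: mult.assoc[symmetric])
      qed
      have main: "\<bar>integral {l..r} g - \<phi>' (F s) * integral {l..r} f\<bar> \<le> e / 2 * (r - l)"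
        if lr: "0 \<le> l" "l \<le> r" "r \<le> T" and near: "\<And>u. u \<in> {l..r} \<Longrightarrow> \<bar>u - s\<bar> < d2" for l r
      proof -
        have "integral {l..r} g - \<phi>' (F s) * integral {l..r} f
            = integral {l..r} (\<lambda>u. g u - \<phi>' (F s) * f u)"
          using lr by (subst Henstock_Kurzweil_Integration.integral_diff)
            (auto intro!: bdd_meas_integrable[where T = T] bg bdd_meas_mult bdd_meas_const bf)
        moreover have "\<bar>integral {l..r} (\<lambda>u. g u - \<phi>' (F s) * f u)\<bar> \<le> (e / 2) * (r - l)"
        proof (intro integral_abs_le_const)
          show "(\<lambda>u. g u - \<phi>' (F s) * f u) integrable_on {l..r}"
            using lr by (auto intro!: bdd_meas_integrable[where T = T] bg bdd_meas_diff bdd_meas_mult bdd_meas_const bf)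
          fix u assume u: "u \<in> {l..r}"
          have "\<bar>g u - \<phi>' (F s) * f u\<bar> = \<bar>\<phi>' (F u) - \<phi>' (F s)\<bar> * \<bar>f u\<bar>"
            unfolding g_def by (simp add: abs_mult[symmetric] algebra_simps)
          also have "\<dots> \<le> e' * C"
            using d2(2)[of u] near[OF u] u lr C(3)[of u] e' by (intro mult_mono) auto
          finally show "\<bar>g u - \<phi>' (F s) * f u\<bar> \<le> e / 2" using e' by simp
        qed (use lr in auto)
        ultimately show ?thesis by simp
      qed
      have G: "primitive T (\<lambda>t. integral {0..t} g) g"
        using bg by (rule primitive_integral)
      have 2: "\<bar>(integral {0..t} g - integral {0..s} g) - \<phi>' (F s) * (F t - F s)\<bar> \<le> e / 2 * \<bar>t - s\<bar>"
      proof (cases "s \<le> t")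
        case True
        then show ?thesis
          using main[of s t] primitive_increment[OF G, of s t] primitive_increment[OF F, of s t] s t dd
          by auto
      next
        case False
        then have "integral {0..s} g - integral {0..t} g = integral {t..s} g"
          "F s - F t = integral {t..s} f"
          using primitive_increment[OF G, of t s] primitive_increment[OF F, of t s] s t by auto
        then have "(integral {0..t} g - integral {0..s} g) - \<phi>' (F s) * (F t - F s)
            = - (integral {t..s} g - \<phi>' (F s) * integral {t..s} f)"
          by (metis (no_types, opaque_lifting) minus_diff_eq minus_diff_commute mult_minus_right)
        then show ?thesis
          using main[of t s] s t dd False
          by (auto simp: abs_minus_commute[of "integral {t..s} g"])
      qed
      have "\<Psi> t - \<Psi> s = (\<phi> (F t) - \<phi> (F s) - \<phi>' (F s) * (F t - F s))
          - ((integral {0..t} g - integral {0..s} g) - \<phi>' (F s) * (F t - F s))"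
        by (simp add: \<Psi>_def)
      then show ?thesis
        using 1 2 by (auto simp: field_simps abs_if split: if_splits)
    qed
    ultimately show "\<exists>d>0. \<forall>y\<in>{0..T}. norm (y - s) < d \<longrightarrow>
        norm (\<Psi> y - \<Psi> s - 0 * (y - s)) \<le> e * norm (y - s)"
      by blast
  qed
  then obtain c where c: "\<And>t. t \<in> {0..T} \<Longrightarrow> \<Psi> t = c"
    using has_field_derivative_zero_constant[of "{0..T}" \<Psi>] by (metis convex_real_interval(5))
  have "\<phi> (F t) - \<phi> (F 0) = integral {0..t} g" if "t \<in> {0..T}" for t
    using c[of t] c[of 0] that by (auto simp: \<Psi>_def)
  then show ?thesis
    using bg unfolding primitive_def g_def by blast
qed

text \<open>The chain rule for squares, by polarisation.\<close>

lemma primitive_mult: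
  assumes F: "primitive T F f" and G: "primitive T G g"
  shows "primitive T (\<lambda>t. F t * G t) (\<lambda>t. f t * G t + F t * g t)"
proof -
  have sq: "primitive T (\<lambda>t. (H t)\<^sup>2) (\<lambda>t. 2 * H t * h t)" if "primitive T H h" for H h
    by (rule primitive_chain[OF that, of UNIV])
       (auto intro!: derivative_eq_intros continuous_intros)
  have "primitive T (\<lambda>t. 1/4 * ((F t + G t)\<^sup>2 - (F t - G t)\<^sup>2))
     (\<lambda>t. 1/4 * (2 * (F t + G t) * (f t + g t) - 2 * (F t - G t) * (f t - g t)))"
    by (intro primitive_cmult primitive_diff sq primitive_add F G)
  then show ?thesis
    by (rule primitive_cong) (auto simp: power2_eq_square algebra_simps)
qed

section \<open>Poisson probabilities and the capped Poisson mean\<close>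

text \<open>The point probability at \<open>j\<close>, as a function of the mean, written out so that it can be
  differentiated and makes sense for every real \<open>c\<close>.\<close>

definition pois :: "nat \<Rightarrow> real \<Rightarrow> real" where
  "pois j c = exp (- c) * c ^ j / fact j"

definition pois_less :: "nat \<Rightarrow> real \<Rightarrow> real" where
  "pois_less k c = (\<Sum>j<k. pois j c)"

text \<open>\<open>E[min(Pois(c), k)]\<close> as the sum over \<open>i < k\<close> of the probabilities that \<open>Pois(c)\<close> exceeds \<open>i\<close>.
  In this form the derivative telescopes to \<open>pois_less k\<close>.\<close>

definition capped_mean :: "nat \<Rightarrow> real \<Rightarrow> real" where
  "capped_mean k c = (\<Sum>i<k. 1 - pois_less (Suc i) c)"

lemma pois_nonneg: "0 \<le> c \<Longrightarrow> 0 \<le> pois j c"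
  by (simp add: pois_def)

lemma pois_at_0: "pois j 0 = (if j = 0 then 1 else 0)"
  by (simp add: pois_def)

lemma pois_less_at_0: "k > 0 \<Longrightarrow> pois_less k 0 = 1"
  by (simp add: pois_less_def pois_at_0)

lemma capped_mean_at_0: "capped_mean k 0 = 0"
  by (simp add: capped_mean_def pois_less_at_0)

lemma pois_0_deriv: "(pois 0 has_real_derivative - pois 0 c) (at c within X)"
  unfolding pois_def by (auto intro!: derivative_eq_intros)

lemma pois_Suc_deriv:
  "(pois (Suc j) has_real_derivative pois j c - pois (Suc j) c) (at c within X)"
proof -
  have 1: "((\<lambda>c. exp (- c) * c ^ Suc j) has_real_derivative
      exp (- c) * (of_nat (Suc j) * c ^ j) - exp (- c) * c ^ Suc j) (at c within X)"
    using DERIV_power[OF DERIV_ident, of "Suc j" c X]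
    by (auto intro!: derivative_eq_intros simp del: power_Suc simp: algebra_simps)
  have 2: "exp (- c) * (of_nat (Suc j) * c ^ j) / fact (Suc j) = exp (- c) * c ^ j / fact j"
    by (simp add: field_simps del: of_nat_Suc)
  show ?thesis
    using DERIV_cdivide[OF 1, of "fact (Suc j)"] 2
    unfolding pois_def[abs_def] by (simp add: diff_divide_distrib del: fact_Suc power_Suc)
qed

lemma pois_less_Suc_deriv: "(pois_less (Suc k) has_real_derivative - pois k c) (at c within X)"
proof (induction k)
  case 0
  have "pois_less (Suc 0) = pois 0"
    by (auto simp: pois_less_def)
  then show ?case
    by (simp add: pois_0_deriv)
next
  case (Suc k)
  have "pois_less (Suc (Suc k)) = (\<lambda>c. pois_less (Suc k) c + pois (Suc k) c)"
    by (auto simp: pois_less_def)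
  then show ?case
    using DERIV_add[OF Suc pois_Suc_deriv[of k c X]] by simp
qed

lemma pois_less_deriv: "k > 0 \<Longrightarrow> (pois_less k has_real_derivative - pois (k - 1) c) (at c within X)"
  using pois_less_Suc_deriv[of "k - 1"] by simp

lemma capped_mean_deriv: "(capped_mean k has_real_derivative pois_less k c) (at c within X)"
  unfolding capped_mean_def[abs_def] pois_less_def[of k]
  by (auto intro!: derivative_eq_intros pois_less_Suc_deriv)

lemma continuous_on_pois: "continuous_on X (pois j)"
  unfolding pois_def[abs_def] by (auto intro!: continuous_intros)

lemma continuous_on_pois_less: "continuous_on X (pois_less k)"
  unfolding pois_less_def[abs_def] by (auto intro!: continuous_intros continuous_on_pois)

lemma continuous_on_capped_mean: "continuous_on X (capped_mean k)"
  unfolding capped_mean_def[abs_def] by (auto intro!: continuous_intros continuous_on_pois_less)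

lemma pois_less_nonneg: "0 \<le> c \<Longrightarrow> 0 \<le> pois_less k c"
  unfolding pois_less_def by (auto intro!: sum_nonneg pois_nonneg)

lemma pois_less_pos:
  assumes "k > 0" "0 \<le> c"
  shows "0 < pois_less k c"
proof -
  have "pois 0 c \<le> pois_less k c"
    unfolding pois_less_def using assms
    by (intro member_le_sum) (auto intro: pois_nonneg)
  then show ?thesis
    by (simp add: pois_def) (smt (verit) exp_gt_zero)
qed

lemma pois_less_antimono:
  assumes "0 \<le> c" "c \<le> d"
  shows "pois_less k d \<le> pois_less k c"
proof (cases k)
  case (Suc j)
  have "pois_less (Suc j) d \<le> pois_less (Suc j) c"
  proof (rule DERIV_nonpos_imp_nonincreasing[OF assms(2)])
    fix x assume "c \<le> x" "x \<le> d"
    then show "\<exists>y. (pois_less (Suc j) has_real_derivative y) (at x) \<and> y \<le> 0"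
      using pois_less_Suc_deriv[of j x UNIV] pois_nonneg[of x j] assms by force
  qed
  then show ?thesis using Suc by simp
qed (simp add: pois_less_def)

lemma capped_mean_mono:
  assumes "0 \<le> c" "c \<le> d"
  shows "capped_mean k c \<le> capped_mean k d"
proof (rule DERIV_nonneg_imp_nondecreasing[OF assms(2)])
  fix x assume "c \<le> x" "x \<le> d"
  then show "\<exists>y. (capped_mean k has_real_derivative y) (at x) \<and> 0 \<le> y"
    using capped_mean_deriv[of k x UNIV] pois_less_nonneg[of x k] assms by force
qed

lemma capped_mean_pos:
  assumes "k > 0" "0 < c"
  shows "0 < capped_mean k c"
proof -
  have "capped_mean k 0 < capped_mean k c"
  proof (rule DERIV_pos_imp_increasing[OF assms(2)])
    fix x assume "0 \<le> x" "x \<le> c"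
    then show "\<exists>y. (capped_mean k has_real_derivative y) (at x) \<and> 0 < y"
      using assms capped_mean_deriv[of k x UNIV] pois_less_pos[of k x] by blast
  qed
  then show ?thesis by (simp add: capped_mean_at_0)
qed

lemma pmf_Pois: "0 \<le> c \<Longrightarrow> pmf (Pois c) j = pois j c"
  by (cases "c = 0") (auto simp: Pois_def pois_def indicator_def)

lemma P_eq_pois_less:
  assumes "K > 0" "0 \<le> c"
  shows "P K c = pois_less K c"
proof -
  have "{n. n \<le> K - 1} = {..<K}"
    using assms by auto
  then show ?thesis
    unfolding P_def pois_less_def using assms
    by (simp add: measure_measure_pmf_finite pmf_Pois)
qed

lemma capped_mean_eq: "capped_mean K c = real K - (\<Sum>j<K. (real K - real j) * pois j c)"
proof (induction K)
  case (Suc K)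
  have "(\<Sum>j<Suc K. (real (Suc K) - real j) * pois j c)
      = (\<Sum>j<Suc K. (real K - real j) * pois j c + pois j c)"
    by (intro sum.cong) (auto simp: algebra_simps)
  also have "\<dots> = (\<Sum>j<K. (real K - real j) * pois j c) + pois_less (Suc K) c"
    by (simp add: sum.distrib pois_less_def)
  finally show ?case
    using Suc by (simp add: capped_mean_def)
qed (simp add: capped_mean_def)

lemma H_eq_capped_mean:
  assumes "0 \<le> c"
  shows "H K c = capped_mean K c"
proof -
  have fin: "(\<Sum>j<K. (real K - real j) * pois j c)
      = measure_pmf.expectation (Pois c) (\<lambda>n. real (K - n))"
    using assms
    by (subst integral_measure_pmf_real[of "{..<K}"])
       (auto simp: pmf_Pois intro!: sum.cong)
  have "measure_pmf.expectation (Pois c) (\<lambda>n. real K - real (K - n))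
      = real K - measure_pmf.expectation (Pois c) (\<lambda>n. real (K - n))"
  proof (subst Bochner_Integration.integral_diff)
    show "integrable (measure_pmf (Pois c)) (\<lambda>n. real (K - n))"
      by (rule measure_pmf.integrable_const_bound[where B = K]) auto
  qed auto
  moreover have "real K - real (K - n) = real (min n K)" for n
    by (auto simp: min_def of_nat_diff)
  ultimately show ?thesis
    unfolding H_def capped_mean_eq fin by simp
qed

text \<open>The reciprocal hazard \<open>pois_less s c / pois (s - 1) c\<close> is a linear combination of powers
  \<open>c\<^sup>-\<^sup>m\<close> with nonnegative coefficients, hence nonincreasing; the claim is the comparison term by term.\<close>

lemma hazard_mono:
  assumes "s > 0" "0 \<le> g" "g \<le> c"
  shows "pois (s - 1) g * pois_less s c \<le> pois (s - 1) c * pois_less s g"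
proof -
  have "pois (s - 1) g * pois j c \<le> pois (s - 1) c * pois j g" if "j < s" for j
  proof -
    define m where "m = s - 1 - j"
    have s: "s - 1 = j + m"
      using that by (simp add: m_def)
    have "g ^ m \<le> c ^ m"
      using assms by (intro power_mono) auto
    then have "(g ^ j * c ^ j) * g ^ m \<le> (g ^ j * c ^ j) * c ^ m"
      using assms by (intro mult_left_mono) auto
    then have "g ^ (s - 1) * c ^ j \<le> c ^ (s - 1) * g ^ j"
      unfolding s power_add by (simp only: ac_simps)
    then have "(g ^ (s - 1) * c ^ j) * (exp (- g) * exp (- c) / (fact (s - 1) * fact j))
        \<le> (c ^ (s - 1) * g ^ j) * (exp (- g) * exp (- c) / (fact (s - 1) * fact j))"
      by (intro mult_right_mono) auto
    then show ?thesis
      by (simp add: pois_def mult.commute mult.left_commute)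
  qed
  then show ?thesis
    unfolding pois_less_def sum_distrib_left by (intro sum_mono) auto
qed

text \<open>The hypothesis \<open>mono\<close> says that \<open>\<psi>' / pois_less s\<close> is nondecreasing, so \<open>\<psi>\<close> is a convex function of
  \<open>capped_mean s\<close>. The conclusion is the inequality of slopes for an increment that lies entirely on
  one side of \<open>g\<close> and points away from it.\<close>

lemma relative_convex_increment:
  assumes deriv: "\<And>c. 0 \<le> c \<Longrightarrow> (\<psi> has_real_derivative \<psi>' c) (at c)"
    and mono: "\<And>g c. 0 \<le> g \<Longrightarrow> g \<le> c \<Longrightarrow> \<psi>' g * pois_less s c \<le> \<psi>' c * pois_less s g"
    and g: "0 \<le> g" and c: "0 \<le> c" "0 \<le> d"
    and order: "g \<le> d \<and> d \<le> c \<or> c \<le> d \<and> d \<le> g"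
  shows "\<psi>' g * (capped_mean s c - capped_mean s d) \<le> pois_less s g * (\<psi> c - \<psi> d)"
proof -
  define f where "f x = pois_less s g * \<psi> x - \<psi>' g * capped_mean s x" for x
  have f': "(f has_real_derivative pois_less s g * \<psi>' x - \<psi>' g * pois_less s x) (at x)" if "0 \<le> x" for x
    unfolding f_def using that
    by (auto intro!: derivative_eq_intros deriv capped_mean_deriv)
  have "f d \<le> f c"
    using order
  proof
    assume o: "g \<le> d \<and> d \<le> c"
    show ?thesis
    proof (rule DERIV_nonneg_imp_nondecreasing[of d c f])
      fix x assume "d \<le> x" "x \<le> c"
      then show "\<exists>y. (f has_real_derivative y) (at x) \<and> 0 \<le> y"
        using f'[of x] mono[of g x] o c g by (force simp: mult.commute)
    qed (use o in auto)
  next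
    assume o: "c \<le> d \<and> d \<le> g"
    show ?thesis
    proof (rule DERIV_nonpos_imp_nonincreasing[of c d f])
      fix x assume "c \<le> x" "x \<le> d"
      then show "\<exists>y. (f has_real_derivative y) (at x) \<and> y \<le> 0"
        using f'[of x] mono[of x g] o c g by (force simp: mult.commute)
    qed (use o in auto)
  qed
  then show ?thesis
    by (simp add: f_def algebra_simps)
qed

section \<open>The controlled chain\<close>

text \<open>Uniqueness for linear equations, with the integrating factor \<open>exp \<rho>\<close>.\<close>

lemma linear_ode_zero:
  assumes D: "primitive T D (\<lambda>t. - r t * D t)" and r: "bdd_meas T r"
    and "D 0 = 0" "t \<in> {0..T}"
  shows "D t = 0"
proof -
  define \<rho> where "\<rho> t = integral {0..t} r" for t
  have "primitive T \<rho> r"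
    unfolding \<rho>_def using r by (rule primitive_integral)
  then have "primitive T (\<lambda>t. exp (\<rho> t)) (\<lambda>t. exp (\<rho> t) * r t)"
    by (rule primitive_chain[of T \<rho> r UNIV exp exp]) (auto intro!: derivative_eq_intros continuous_intros)
  from primitive_mult[OF D this]
  have *: "primitive T (\<lambda>t. D t * exp (\<rho> t)) (\<lambda>t. 0)"
    by (rule primitive_cong) (auto simp: algebra_simps)
  have "D t * exp (\<rho> t) - D 0 * exp (\<rho> 0) = integral {0..t} (\<lambda>_. 0)"
    using * assms(4) unfolding primitive_def by blast
  then show ?thesis
    using assms by simp
qed

text \<open>The rate \<open>\<alpha>\<close> does not act on the chain; it enters through the service it counts. Taking \<open>\<alpha> = \<beta>1\<close>
  turns the service of the third constraint into that of the fourth.\<close>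

locale controlled_chain =
  fixes K s2 :: nat and T :: real and \<beta>1 \<beta>2 \<alpha> :: "real \<Rightarrow> real" and x :: "nat \<Rightarrow> real \<Rightarrow> real"
  assumes T: "0 \<le> T" and s2: "1 \<le> s2" "s2 < K"
    and \<beta>1: "bdd_meas T \<beta>1" and \<beta>2: "bdd_meas T \<beta>2" and \<alpha>: "bdd_meas T \<alpha>"
    and sol: "is_solution K s2 T \<beta>1 \<beta>2 x"
begin

definition \<sigma> :: "real \<Rightarrow> real" where "\<sigma> t = integral {0..t} \<beta>1"
text \<open>The \<open>\<beta>2\<close>-clock that remains at time \<open>t\<close>; likewise \<open>D\<close> for \<open>\<alpha>\<close>.\<close>

definition G :: "real \<Rightarrow> real" where "G t = integral {t..T} \<beta>2"
definition D :: "real \<Rightarrow> real" where "D t = integral {t..T} \<alpha>"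

text \<open>The flow from the upper block into the lower block.\<close>

definition entry :: "real \<Rightarrow> real" where "entry t = \<beta>1 t * pois (K - s2 - 1) (\<sigma> t)"

lemma primitive_\<sigma>: "primitive T \<sigma> \<beta>1"
  unfolding \<sigma>_def using primitive_integral[OF \<beta>1] by simp

lemma primitive_tail:
  assumes "bdd_meas T f"
  shows "primitive T (\<lambda>t. integral {t..T} f) (\<lambda>t. - f t)"
proof -
  have F: "primitive T (\<lambda>t. integral {0..t} f) f"
    using assms by (rule primitive_integral)
  show ?thesis
    by (rule primitive_cong[OF primitive_diff[OF primitive_const[of T "integral {0..T} f"] F]])
      (use primitive_increment[OF F] in auto)
qed

lemma primitive_G: "primitive T G (\<lambda>t. - \<beta>2 t)"
  unfolding G_def using primitive_tail[OF \<beta>2] by simp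

lemma primitive_D: "primitive T D (\<lambda>t. - \<alpha> t)"
  unfolding D_def using primitive_tail[OF \<alpha>] by simp

lemma \<sigma>_0: "\<sigma> 0 = 0" and G_T: "G T = 0" and D_T: "D T = 0"
  by (simp_all add: \<sigma>_def G_def D_def)

lemma continuous_x: "k \<in> {1..K} \<Longrightarrow> continuous_on {0..T} (x k)"
  using sol unfolding is_solution_def by blast

lemma bdd_meas_x: "k \<in> {1..K} \<Longrightarrow> bdd_meas T (x k)"
  using bdd_meas_continuous continuous_x by blast

lemma bdd_meas_flow:
  assumes "k \<ge> 1"
  shows "bdd_meas T (flow K s2 \<beta>1 \<beta>2 x k)"
proof (cases "k \<le> K")
  case True
  then have "bdd_meas T (x k)"
    using assms by (simp add: bdd_meas_x)
  then show ?thesis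
    using True s2 unfolding flow_def
    by (cases "k \<le> s2") (simp_all add: bdd_meas_mult \<beta>1 \<beta>2)
next
  case False
  then show ?thesis
    using s2 unfolding flow_def by (simp add: bdd_meas_const)
qed

lemma x_0:
  assumes "k \<in> {1..K}"
  shows "x k 0 = (if k = K then 1 else 0)"
proof -
  have "x k 0 = (if k = K then 1 else 0) +
      (LINT u:{0..0}|lebesgue. - (flow K s2 \<beta>1 \<beta>2 x k u - flow K s2 \<beta>1 \<beta>2 x (k + 1) u))"
    using sol assms T unfolding is_solution_def by (auto simp del: atLeastAtMost_singleton)
  moreover have "(LINT u:{0..0}|lebesgue. - (flow K s2 \<beta>1 \<beta>2 x k u - flow K s2 \<beta>1 \<beta>2 x (k + 1) u)) = 0"
    using assms T
    by (subst bdd_meas_set_integral[where T = T])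
      (auto intro!: bdd_meas_uminus bdd_meas_diff bdd_meas_flow simp del: minus_diff_eq)
  ultimately show ?thesis by simp
qed

lemma primitive_x:
  assumes k: "k \<in> {1..K}"
  shows "primitive T (x k) (\<lambda>t. flow K s2 \<beta>1 \<beta>2 x (k + 1) t - flow K s2 \<beta>1 \<beta>2 x k t)"
    (is "primitive T _ ?f")
proof -
  have b: "bdd_meas T ?f"
    using k by (intro bdd_meas_diff bdd_meas_flow) auto
  have "x k t - x k 0 = integral {0..t} ?f" if t: "t \<in> {0..T}" for t
  proof -
    have "x k t = (if k = K then 1 else 0) +
        (LINT u:{0..t}|lebesgue. - (flow K s2 \<beta>1 \<beta>2 x k u - flow K s2 \<beta>1 \<beta>2 x (k + 1) u))"
      using sol k t unfolding is_solution_def by blast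
    also have "(\<lambda>u. - (flow K s2 \<beta>1 \<beta>2 x k u - flow K s2 \<beta>1 \<beta>2 x (k + 1) u)) = ?f"
      by auto
    also have "(LINT u:{0..t}|lebesgue. ?f u) = integral {0..t} ?f"
      using t by (intro bdd_meas_set_integral[OF b]) auto
    finally show ?thesis
      using x_0[OF k] by simp
  qed
  then show ?thesis
    using b unfolding primitive_def by blast
qed

text \<open>Both sides satisfy the same linear equation with the same source \<open>\<beta>1 x (k + 1)\<close>.\<close>

lemma upper_eq_pois:
  assumes "k \<in> {s2+1..K}" "t \<in> {0..T}"
  shows "x k t = pois (K - k) (\<sigma> t)"
  using assms
proof (induction "K - k" arbitrary: k t)
  case 0
  then have k: "k = K" by simp
  have p: "primitive T (\<lambda>t. pois 0 (\<sigma> t)) (\<lambda>t. - pois 0 (\<sigma> t) * \<beta>1 t)"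
    by (rule primitive_chain[OF primitive_\<sigma>, of UNIV])
      (auto intro!: pois_0_deriv continuous_intros continuous_on_pois)
  have "primitive T (\<lambda>t. x K t - pois 0 (\<sigma> t)) (\<lambda>t. - \<beta>1 t * (x K t - pois 0 (\<sigma> t)))"
    by (rule primitive_cong[OF primitive_diff[OF primitive_x[of K] p]])
      (use s2 in \<open>auto simp: flow_def algebra_simps\<close>)
  then have "x K t - pois 0 (\<sigma> t) = 0"
    by (rule linear_ode_zero[OF _ \<beta>1])
      (use 0 s2 in \<open>auto simp: x_0 \<sigma>_0 pois_at_0\<close>)
  then show ?case
    using k by simp
next
  case (Suc i)
  have k: "k \<in> {1..K}" "Suc k \<in> {s2+1..K}" "i = K - Suc k" "k \<noteq> K" "K - k = Suc i"
    using Suc by auto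
  have IH: "x (Suc k) u = pois i (\<sigma> u)" if "u \<in> {0..T}" for u
    using Suc.hyps(1)[OF k(3) k(2) that] k by simp
  have p: "primitive T (\<lambda>t. pois (Suc i) (\<sigma> t)) (\<lambda>t. (pois i (\<sigma> t) - pois (Suc i) (\<sigma> t)) * \<beta>1 t)"
    by (rule primitive_chain[OF primitive_\<sigma>, of UNIV])
      (auto intro!: pois_Suc_deriv continuous_intros continuous_on_pois)
  have "primitive T (\<lambda>t. x k t - pois (Suc i) (\<sigma> t)) (\<lambda>t. - \<beta>1 t * (x k t - pois (Suc i) (\<sigma> t)))"
    by (rule primitive_cong[OF primitive_diff[OF primitive_x[OF k(1)] p]])
      (use k Suc.prems IH in \<open>auto simp: flow_def algebra_simps\<close>)
  then have "x k t - pois (Suc i) (\<sigma> t) = 0"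
    by (rule linear_ode_zero[OF _ \<beta>1])
      (use k Suc.prems in \<open>auto simp: x_0 \<sigma>_0 pois_at_0\<close>)
  then show ?case
    using k by simp
qed

lemma upper_sum:
  assumes "t \<in> {0..T}"
  shows "(\<Sum>k=s2+1..K. x k t) = pois_less (K - s2) (\<sigma> t)"
proof -
  have "(\<Sum>k=s2+1..K. x k t) = (\<Sum>k=s2+1..K. pois (K - k) (\<sigma> t))"
    using assms by (intro sum.cong upper_eq_pois) auto
  also have "\<dots> = (\<Sum>j<K - s2. pois j (\<sigma> t))"
    by (rule sum.reindex_bij_witness[of _ "\<lambda>j. K - j" "\<lambda>k. K - k"]) (use s2 in auto)
  finally show ?thesis
    by (simp add: pois_less_def)
qed

lemma bdd_meas_\<sigma>: "continuous_on UNIV f \<Longrightarrow> bdd_meas T (\<lambda>t. f (\<sigma> t))"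
  by (rule bdd_meas_continuous)
    (erule continuous_on_compose2[OF _ primitive_continuous[OF primitive_\<sigma>]], simp)

lemma bdd_meas_G: "continuous_on UNIV f \<Longrightarrow> bdd_meas T (\<lambda>t. f (G t))"
  by (rule bdd_meas_continuous)
    (erule continuous_on_compose2[OF _ primitive_continuous[OF primitive_G]], simp)

lemma bdd_meas_entry: "bdd_meas T entry"
  unfolding entry_def[abs_def]
  by (intro bdd_meas_mult \<beta>1 bdd_meas_\<sigma> continuous_on_pois)

text \<open>The function \<open>w k (G t)\<close> solves the backward equation of the lower block, with boundary value \<open>w 0 = 0\<close>
  and running reward \<open>e\<close> per unit of \<open>\<beta>2\<close>-clock. Hence the derivative of the sum of \<open>x k t * w k (G t)\<close>
  telescopes, and only the flow at the upper boundary and the reward remain. With \<open>e = 0\<close> this computes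
  the mass that survives, with \<open>e = 1\<close> the number of jumps, for an arbitrary solution.\<close>

lemma lower_duality:
  assumes w0: "\<And>c. w 0 c = 0"
    and w': "\<And>k c. (w (Suc k) has_real_derivative e - w (Suc k) c + w k c) (at c)"
  shows "(\<Sum>k=1..s2. x k T * w k 0)
      = integral {0..T} (\<lambda>t. entry t * w s2 (G t))
        - e * integral {0..T} (\<lambda>t. \<beta>2 t * (\<Sum>k=1..s2. x k t))"
proof -
  have wcont: "continuous_on UNIV (w k)" for k
  proof (cases k)
    case 0
    then have "w k = (\<lambda>_. 0)" using w0 by auto
    then show ?thesis by simp
  next
    case (Suc j)
    then show ?thesis
      using w'[of j] by (auto intro!: DERIV_continuous_on)
  qed
  define dw where "dw k c = e - w k c + w (k - 1) c" for k c
  have dwcont: "continuous_on UNIV (dw k)" for k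
    unfolding dw_def[abs_def] by (intro continuous_intros wcont)
  define f where "f k = flow K s2 \<beta>1 \<beta>2 x k" for k
  define g where "g t = (\<Sum>k=1..s2. (f (k + 1) t - f k t) * w k (G t) + x k t * (dw k (G t) * (- \<beta>2 t)))" for t
  have prim: "primitive T (\<lambda>t. \<Sum>k=1..s2. x k t * w k (G t)) g"
    unfolding g_def[abs_def] f_def
  proof (intro primitive_sum primitive_mult primitive_x)
    fix k assume k: "k \<in> {1..s2}"
    show "primitive T (\<lambda>t. w k (G t)) (\<lambda>t. dw k (G t) * (- \<beta>2 t))"
      by (rule primitive_chain[OF primitive_G _ _ dwcont])
        (use k w'[of "k - 1"] in \<open>auto simp: dw_def\<close>)
  qed (use s2 in auto)
  have g: "g t = entry t * w s2 (G t) - e * (\<beta>2 t * (\<Sum>k=1..s2. x k t))" if t: "t \<in> {0..T}" for t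
  proof -
    have tele: "(\<Sum>k=1..m. (f (k + 1) t - f k t) * w k (G t) + x k t * (dw k (G t) * (- \<beta>2 t)))
        = f (Suc m) t * w m (G t) - e * (\<beta>2 t * (\<Sum>k=1..m. x k t))" if "m \<le> s2" for m
      using that
    proof (induction m)
      case 0
      then show ?case by (simp add: w0)
    next
      case (Suc m)
      have "f (Suc m) t = \<beta>2 t * x (Suc m) t"
        using Suc.prems by (simp add: f_def flow_def)
      then show ?case
        using Suc by (simp add: dw_def algebra_simps)
    qed
    have "f (Suc s2) t = entry t"
      using s2 t upper_eq_pois[of "Suc s2" t] by (simp add: f_def flow_def entry_def)
    then show ?thesis
      unfolding g_def using tele[of s2] by simp
  qed
  have "(\<Sum>k=1..s2. x k T * w k (G T)) - (\<Sum>k=1..s2. x k 0 * w k (G 0)) = integral {0..T} g"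
    using prim T unfolding primitive_def by auto
  moreover have "(\<Sum>k=1..s2. x k 0 * w k (G 0)) = 0"
    using s2 by (intro sum.neutral) (auto simp: x_0)
  moreover have "integral {0..T} g =
      integral {0..T} (\<lambda>t. entry t * w s2 (G t) - e * (\<beta>2 t * (\<Sum>k=1..s2. x k t)))"
    using g by (intro Henstock_Kurzweil_Integration.integral_cong) auto
  moreover have "\<dots> = integral {0..T} (\<lambda>t. entry t * w s2 (G t))
        - integral {0..T} (\<lambda>t. e * (\<beta>2 t * (\<Sum>k=1..s2. x k t)))"
    using T s2
    by (intro integral_diff_on[where T = T] bdd_meas_mult bdd_meas_const bdd_meas_sum
        bdd_meas_entry \<beta>2 bdd_meas_x bdd_meas_G wcont) auto
  ultimately show ?thesis
    by (simp add: G_T)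
qed

lemma lower_alive:
  "(\<Sum>k=1..s2. x k T) = integral {0..T} (\<lambda>t. entry t * pois_less s2 (G t))"
proof -
  have "(\<Sum>k=1..s2. x k T * pois_less k 0) = integral {0..T} (\<lambda>t. entry t * pois_less s2 (G t))
        - 0 * integral {0..T} (\<lambda>t. \<beta>2 t * (\<Sum>k=1..s2. x k t))"
  proof (rule lower_duality)
    fix k c
    show "(pois_less (Suc k) has_real_derivative 0 - pois_less (Suc k) c + pois_less k c) (at c)"
      using pois_less_Suc_deriv[of k c UNIV] by (simp add: pois_less_def)
  qed (simp add: pois_less_def)
  moreover have "(\<Sum>k=1..s2. x k T * pois_less k 0) = (\<Sum>k=1..s2. x k T)"
    by (intro sum.cong) (auto simp: pois_less_at_0)
  ultimately show ?thesis by simp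
qed

lemma lower_service:
  "integral {0..T} (\<lambda>t. \<beta>2 t * (\<Sum>k=1..s2. x k t))
     = integral {0..T} (\<lambda>t. entry t * capped_mean s2 (G t))"
proof -
  have "(\<Sum>k=1..s2. x k T * capped_mean k 0) = integral {0..T} (\<lambda>t. entry t * capped_mean s2 (G t))
        - 1 * integral {0..T} (\<lambda>t. \<beta>2 t * (\<Sum>k=1..s2. x k t))"
  proof (rule lower_duality)
    fix k c
    show "(capped_mean (Suc k) has_real_derivative 1 - capped_mean (Suc k) c + capped_mean k c) (at c)"
      using capped_mean_deriv[of "Suc k" c UNIV] by (simp add: capped_mean_def)
  qed (simp add: capped_mean_def)
  then show ?thesis by (simp add: capped_mean_at_0)
qed

lemma primitive_upper: "primitive T (\<lambda>t. pois_less (K - s2) (\<sigma> t)) (\<lambda>t. - entry t)"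
proof -
  have "primitive T (\<lambda>t. pois_less (K - s2) (\<sigma> t)) (\<lambda>t. - pois (K - s2 - 1) (\<sigma> t) * \<beta>1 t)"
    by (rule primitive_chain[OF primitive_\<sigma>, of UNIV])
      (use s2 pois_less_deriv[of "K - s2"] in
        \<open>auto intro!: continuous_intros continuous_on_pois\<close>)
  then show ?thesis
    by (rule primitive_cong) (auto simp: entry_def)
qed

lemma upper_alive: "pois_less (K - s2) (\<sigma> T) = 1 - integral {0..T} entry"
proof -
  have "pois_less (K - s2) (\<sigma> T) - pois_less (K - s2) (\<sigma> 0) = integral {0..T} (\<lambda>t. - entry t)"
    using primitive_upper T unfolding primitive_def by auto
  then show ?thesis
    using s2 by (simp add: \<sigma>_0 pois_less_at_0)
qed

text \<open>Integration by parts of \<open>D\<close> against the mass of the upper block, whose derivative is \<open>- entry\<close>.\<close>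

lemma upper_service:
  "integral {0..T} (\<lambda>t. \<alpha> t * (\<Sum>k=s2+1..K. x k t))
     = D 0 - integral {0..T} (\<lambda>t. entry t * D t)"
proof -
  have p: "primitive T (\<lambda>t. D t * pois_less (K - s2) (\<sigma> t))
      (\<lambda>t. - \<alpha> t * pois_less (K - s2) (\<sigma> t) + D t * - entry t)"
    by (intro primitive_mult primitive_D primitive_upper)
  have bD: "bdd_meas T D"
    using bdd_meas_continuous primitive_continuous primitive_D by blast
  have "D T * pois_less (K - s2) (\<sigma> T) - D 0 * pois_less (K - s2) (\<sigma> 0)
      = integral {0..T} (\<lambda>t. - \<alpha> t * pois_less (K - s2) (\<sigma> t) + D t * - entry t)"
    using p T unfolding primitive_def by auto
  also have "\<dots> = integral {0..T} (\<lambda>t. - (\<alpha> t * pois_less (K - s2) (\<sigma> t)) - entry t * D t)"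
    by (intro Henstock_Kurzweil_Integration.integral_cong) auto
  also have "\<dots> = integral {0..T} (\<lambda>t. - (\<alpha> t * pois_less (K - s2) (\<sigma> t)))
      - integral {0..T} (\<lambda>t. entry t * D t)"
    using T by (intro integral_diff_on[where T = T] bdd_meas_uminus bdd_meas_mult \<alpha>
        bdd_meas_\<sigma> continuous_on_pois_less bdd_meas_entry bD) auto
  also have "integral {0..T} (\<lambda>t. - (\<alpha> t * pois_less (K - s2) (\<sigma> t)))
      = - integral {0..T} (\<lambda>t. \<alpha> t * (\<Sum>k=s2+1..K. x k t))"
    by (subst Henstock_Kurzweil_Integration.integral_neg[symmetric])
      (auto intro!: Henstock_Kurzweil_Integration.integral_cong simp: upper_sum[simplified])
  finally show ?thesis
    using s2 by (simp add: D_T \<sigma>_0 pois_less_at_0)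
qed

lemma alive_eq:
  "(\<Sum>k=1..K. x k T) = 1 - integral {0..T} (\<lambda>t. entry t * (1 - pois_less s2 (G t)))"
proof -
  have "(\<Sum>k=1..K. x k T) = (\<Sum>k=1..s2. x k T) + (\<Sum>k=s2+1..K. x k T)"
    using s2 sum.ub_add_nat[of 1 s2 "\<lambda>k. x k T" "K - s2"] by auto
  also have "\<dots> = integral {0..T} (\<lambda>t. entry t * pois_less s2 (G t)) + (1 - integral {0..T} entry)"
    using lower_alive upper_sum[of T] upper_alive T by simp
  also have "\<dots> = 1 - integral {0..T} (\<lambda>t. entry t - entry t * pois_less s2 (G t))"
    using T by (subst integral_diff_on[where T = T])
      (auto intro!: bdd_meas_mult bdd_meas_entry bdd_meas_G continuous_on_pois_less)
  finally show ?thesis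
    by (simp add: right_diff_distrib)
qed

lemma service_eq:
  "(LINT t:{0..T}|lebesgue. \<beta>2 t * (\<Sum>k=1..s2. x k t) + \<alpha> t * (\<Sum>k=s2+1..K. x k t))
     = integral {0..T} (\<lambda>t. entry t * capped_mean s2 (G t))
       + D 0 - integral {0..T} (\<lambda>t. entry t * D t)" (is ?thesis1)
  "(\<Sum>k=1..s2. LINT t:{0..T}|lebesgue. \<beta>2 t * x k t) +
       (\<Sum>k=s2+1..K. LINT t:{0..T}|lebesgue. \<alpha> t * x k t)
     = integral {0..T} (\<lambda>t. entry t * capped_mean s2 (G t))
       + D 0 - integral {0..T} (\<lambda>t. entry t * D t)" (is ?thesis2)
proof -
  have b: "bdd_meas T (\<lambda>t. \<beta>2 t * (\<Sum>k=1..s2. x k t))"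
    "bdd_meas T (\<lambda>t. \<alpha> t * (\<Sum>k=s2+1..K. x k t))"
    using s2 by (auto intro!: bdd_meas_mult bdd_meas_sum \<alpha> \<beta>2 bdd_meas_x)
  have "(LINT t:{0..T}|lebesgue. \<beta>2 t * (\<Sum>k=1..s2. x k t) + \<alpha> t * (\<Sum>k=s2+1..K. x k t))
     = integral {0..T} (\<lambda>t. \<beta>2 t * (\<Sum>k=1..s2. x k t))
       + integral {0..T} (\<lambda>t. \<alpha> t * (\<Sum>k=s2+1..K. x k t))"
    using T b by (subst bdd_meas_set_integral[where T = T])
      (auto intro!: bdd_meas_add integral_add_on[where T = T])
  then show ?thesis1
    unfolding lower_service upper_service by simp
  have s: "integral {0..T} (\<lambda>t. r t * (\<Sum>k\<in>I. x k t)) = (\<Sum>k\<in>I. LINT t:{0..T}|lebesgue. r t * x k t)"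
    if "I \<subseteq> {1..K}" "bdd_meas T r" for I r
  proof -
    have fin: "finite I" using that finite_subset by blast
    have m: "bdd_meas T (\<lambda>t. r t * x k t)" if "k \<in> I" for k
      using that \<open>I \<subseteq> {1..K}\<close> \<open>bdd_meas T r\<close> by (auto intro!: bdd_meas_mult bdd_meas_x)
    have "integral {0..T} (\<lambda>t. \<Sum>k\<in>I. r t * x k t) = (\<Sum>k\<in>I. integral {0..T} (\<lambda>t. r t * x k t))"
      using m fin by (intro Henstock_Kurzweil_Integration.integral_sum bdd_meas_integrable[where T = T]) auto
    then show ?thesis
      using m by (simp add: sum_distrib_left bdd_meas_set_integral[where T = T])
  qed
  show ?thesis2
    using s[of "{1..s2}" \<beta>2] s[of "{s2+1..K}" \<alpha>] \<alpha> \<beta>2 s2 lower_service upper_service by auto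
qed

end

section \<open>Existence of solutions\<close>

lemma linear_ode_exists:
  assumes r: "bdd_meas T r" and g: "bdd_meas T g"
  shows "\<exists>y. y 0 = y0 \<and> primitive T y (\<lambda>t. g t - r t * y t)"
proof -
  define \<rho> where "\<rho> t = integral {0..t} r" for t
  have \<rho>: "primitive T \<rho> r"
    unfolding \<rho>_def using r by (rule primitive_integral)
  have e1: "primitive T (\<lambda>t. exp (\<rho> t)) (\<lambda>t. exp (\<rho> t) * r t)"
    by (rule primitive_chain[OF \<rho>, of UNIV]) (auto intro!: derivative_eq_intros continuous_intros)
  have e2: "primitive T (\<lambda>t. exp (- \<rho> t)) (\<lambda>t. - exp (- \<rho> t) * r t)"
    by (rule primitive_chain[OF \<rho>, of UNIV]) (auto intro!: derivative_eq_intros continuous_intros)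
  define k where "k t = exp (\<rho> t) * g t" for t
  have k: "bdd_meas T k"
    unfolding k_def[abs_def]
    using bdd_meas_mult[OF bdd_meas_continuous[OF primitive_continuous[OF e1]] g] .
  define y where "y t = exp (- \<rho> t) * (y0 + integral {0..t} k)" for t
  have "primitive T y (\<lambda>t. (- exp (- \<rho> t) * r t) * (y0 + integral {0..t} k)
      + exp (- \<rho> t) * (0 + k t))"
    unfolding y_def[abs_def]
    by (intro primitive_mult e2 primitive_add primitive_const primitive_integral k)
  then have "primitive T y (\<lambda>t. g t - r t * y t)"
    by (rule primitive_cong) (auto simp: y_def k_def exp_minus field_simps)
  moreover have "y 0 = y0"
    by (simp add: y_def \<rho>_def)
  ultimately show ?thesis by blast
qed

text \<open>Downward recursion on \<open>k\<close>: given the component \<open>k + 1\<close>, the equation for \<open>x k\<close> is a scalar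
  linear one.\<close>

lemma solution_exists:
  assumes s2: "s2 < K" and \<beta>: "bdd_meas T \<beta>1" "bdd_meas T \<beta>2"
  shows "\<exists>x. is_solution K s2 T \<beta>1 \<beta>2 x"
proof -
  let ?sol = "\<lambda>x k. primitive T (x k) (\<lambda>t. flow K s2 \<beta>1 \<beta>2 x (k + 1) t - flow K s2 \<beta>1 \<beta>2 x k t)
      \<and> x k 0 = (if k = K then 1 else 0)"
  have "\<exists>x. \<forall>k. k \<le> K \<and> K < k + j \<longrightarrow> ?sol x k" for j
  proof (induction j)
    case 0
    then show ?case by auto
  next
    case (Suc j)
    then obtain x where x: "\<And>k. k \<le> K \<Longrightarrow> K < k + j \<Longrightarrow> ?sol x k" by blast
    define m where "m = K - j"
    show ?case
    proof (cases "j \<le> K")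
      case False
      then show ?thesis using x by (intro exI[of _ x]) auto
    next
      case True
      then have m: "m \<le> K" "m + j = K"
        by (auto simp: m_def)
      define r where "r = (if m \<le> s2 then \<beta>2 else \<beta>1)"
      have r: "bdd_meas T r"
        using \<beta> by (simp add: r_def)
      have g: "bdd_meas T (flow K s2 \<beta>1 \<beta>2 x (m + 1))"
      proof (cases "m + 1 \<le> K")
        case True
        then have "?sol x (m + 1)"
          using m x[of "m + 1"] by simp
        then have "bdd_meas T (x (m + 1))"
          using bdd_meas_continuous primitive_continuous by blast
        then show ?thesis
          using True \<beta> unfolding flow_def by (cases "m + 1 \<le> s2") (simp_all add: bdd_meas_mult)
      next
        case False
        then show ?thesis
          using s2 unfolding flow_def by (simp add: bdd_meas_const)
      qed
      obtain y where y: "y 0 = (if m = K then 1 else 0)"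
        "primitive T y (\<lambda>t. flow K s2 \<beta>1 \<beta>2 x (m + 1) t - r t * y t)"
        using linear_ode_exists[OF r g] by blast
      define x' where "x' = x(m := y)"
      have fl: "flow K s2 \<beta>1 \<beta>2 x' k = flow K s2 \<beta>1 \<beta>2 x k" if "k \<noteq> m" for k
        using that by (auto simp: flow_def x'_def fun_eq_iff)
      have flm: "flow K s2 \<beta>1 \<beta>2 x' m = (\<lambda>t. r t * y t)"
        using m by (auto simp: flow_def x'_def r_def fun_eq_iff)
      have "?sol x' k" if k: "k \<le> K" "K < k + Suc j" for k
      proof (cases "k = m")
        case True
        have "x' m = y" "flow K s2 \<beta>1 \<beta>2 x' (m + 1) = flow K s2 \<beta>1 \<beta>2 x (m + 1)"
          using fl[of "m + 1"] by (simp_all add: x'_def)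
        then show ?thesis
          unfolding True flm using y by metis
      next
        case False
        then have "K < k + j"
          using k m by auto
        moreover have "x' k = x k" "k + 1 \<noteq> m"
          using False k m by (auto simp: x'_def)
        ultimately show ?thesis
          using x[of k] k fl[OF False] fl[of "k + 1"] by metis
      qed
      then show ?thesis by blast
    qed
  qed
  then obtain x where x: "\<And>k. k \<in> {1..K} \<Longrightarrow> ?sol x k"
    by (metis atLeastAtMost_iff less_add_same_cancel2 less_le_trans zero_less_one)
  have "is_solution K s2 T \<beta>1 \<beta>2 x"
    unfolding is_solution_def
  proof (intro ballI conjI)
    fix k assume k: "k \<in> {1..K}"
    show "continuous_on {0..T} (x k)"
      using x[OF k] primitive_continuous by blast
    fix t assume t: "t \<in> {0..T}"
    let ?f = "\<lambda>t. flow K s2 \<beta>1 \<beta>2 x (k + 1) t - flow K s2 \<beta>1 \<beta>2 x k t"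
    have "x k t - x k 0 = integral {0..t} ?f"
      using x[OF k] t unfolding primitive_def by blast
    also have "\<dots> = (LINT u:{0..t}|lebesgue. ?f u)"
      using t x[OF k] by (intro bdd_meas_set_integral[symmetric, where T = T]) (auto simp: primitive_bdd_meas)
    also have "?f = (\<lambda>u. - (flow K s2 \<beta>1 \<beta>2 x k u - flow K s2 \<beta>1 \<beta>2 x (k + 1) u))"
      by auto
    finally show "x k t = (if k = K then 1 else 0) +
           (LINT u:{0..t}|lebesgue. - (flow K s2 \<beta>1 \<beta>2 x k u - flow K s2 \<beta>1 \<beta>2 x (k + 1) u))"
      using x[OF k] by linarith
  qed
  then show ?thesis by blast
qed

section \<open>Closed forms in the time scale of the upper clock\<close>

text \<open>For the policy that serves the lower block on \<open>[a, b]\<close> in the time scale of the upper clock,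
  \<open>residual_beta2 a b s\<close> is the lower clock that remains when the upper clock shows \<open>s\<close>.\<close>

definition residual_beta2 :: "real \<Rightarrow> real \<Rightarrow> real \<Rightarrow> real" where
  "residual_beta2 a b s = min (b - a) (max 0 (b - s))"

text \<open>The largest possible remaining \<open>\<alpha>\<close>-mass when the upper clock shows \<open>s\<close>: at most the upper clock
  that is left, and at most \<open>\<Lambda>\<close> minus the \<open>\<beta>2\<close>-mass already spent, because \<open>\<beta>2 \<le> \<alpha> \<le> \<beta>1\<close>.
  Postponing \<open>\<alpha>\<close> as in \<open>alphaz\<close> attains the smaller of the two bounds throughout.\<close>

definition residual_alpha :: "real \<Rightarrow> real \<Rightarrow> real \<Rightarrow> real \<Rightarrow> real \<Rightarrow> real" where
  "residual_alpha S a b \<Lambda> s = min (max 0 (S - s)) (\<Lambda> - (b - a) + residual_beta2 a b s)"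

text \<open>The closed forms below integrate up to \<open>M\<close> instead of \<open>S\<close>. Their integrands vanish beyond \<open>S\<close>,
  and with a fixed domain of integration their continuity in the parameters is immediate.\<close>

definition lower_service_form :: "nat \<Rightarrow> nat \<Rightarrow> real \<Rightarrow> real \<Rightarrow> real \<Rightarrow> real" where
  "lower_service_form K s2 M a b =
     integral {0..M} (\<lambda>s. pois (K - s2 - 1) s * capped_mean s2 (residual_beta2 a b s))"

fun alive_form :: "nat \<Rightarrow> nat \<Rightarrow> real \<Rightarrow> params \<Rightarrow> real" where
  "alive_form K s2 M (S, a, b, \<Lambda>) =
     1 - integral {0..M} (\<lambda>s. pois (K - s2 - 1) s * (1 - pois_less s2 (residual_beta2 a b s)))"

fun upper_form :: "nat \<Rightarrow> nat \<Rightarrow> params \<Rightarrow> real" where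
  "upper_form K s2 (S, a, b, \<Lambda>) = pois_less (K - s2) S"

fun alpha_service_form :: "nat \<Rightarrow> nat \<Rightarrow> real \<Rightarrow> params \<Rightarrow> real" where
  "alpha_service_form K s2 M (S, a, b, \<Lambda>) = lower_service_form K s2 M a b
     + \<Lambda> - integral {0..M} (\<lambda>s. pois (K - s2 - 1) s * residual_alpha S a b \<Lambda> s)"

fun full_service_form :: "nat \<Rightarrow> nat \<Rightarrow> real \<Rightarrow> params \<Rightarrow> real" where
  "full_service_form K s2 M (S, a, b, \<Lambda>) = lower_service_form K s2 M a b
     + S - integral {0..M} (\<lambda>s. pois (K - s2 - 1) s * max 0 (S - s))"

lemma continuous_residual_beta2: "continuous_on X (residual_beta2 a b)"
  unfolding residual_beta2_def[abs_def] by (intro continuous_intros)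

lemma continuous_residual_alpha: "continuous_on X (residual_alpha S a b \<Lambda>)"
  unfolding residual_alpha_def[abs_def] by (intro continuous_intros continuous_residual_beta2)

lemma integral_truncate:
  fixes F :: "real \<Rightarrow> real"
  assumes "continuous_on UNIV F" "\<And>s. s \<in> {S..M} \<Longrightarrow> F s = 0" "0 \<le> S" "S \<le> M"
  shows "integral {0..S} F = integral {0..M} F"
proof -
  have "integral {0..S} F + integral {S..M} F = integral {0..M} F"
    using assms continuous_on_subset[OF assms(1) subset_UNIV]
    by (intro Henstock_Kurzweil_Integration.integral_combine integrable_continuous_real) auto
  moreover have "integral {S..M} F = integral {S..M} (\<lambda>_. 0)"
    using assms by (intro Henstock_Kurzweil_Integration.integral_cong) auto
  ultimately show ?thesis by simp
qed

context controlled_chain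
begin

text \<open>The change of variables \<open>s = \<sigma> t\<close>. As \<open>\<sigma>\<close> may be constant on sets of positive measure and is only
  absolutely continuous, this is the chain rule for the primitive of the integrand.\<close>

lemma entry_integral:
  assumes nonneg: "\<And>t. t \<in> {0..T} \<Longrightarrow> 0 \<le> \<beta>1 t" and M: "\<sigma> T \<le> M"
    and F: "continuous_on UNIV F" "\<And>s. s \<in> {\<sigma> T..M} \<Longrightarrow> F s = 0"
  shows "integral {0..T} (\<lambda>t. entry t * F (\<sigma> t))
    = integral {0..M} (\<lambda>s. pois (K - s2 - 1) s * F s)"
proof -
  let ?F = "\<lambda>s. pois (K - s2 - 1) s * F s"
  have contF: "continuous_on UNIV ?F"
    by (intro continuous_intros continuous_on_pois F)
  have mono: "\<sigma> s \<le> \<sigma> t" if "0 \<le> s" "s \<le> t" "t \<le> T" for s t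
  proof -
    have "0 \<le> integral {s..t} \<beta>1"
      using that nonneg by (intro Henstock_Kurzweil_Integration.integral_nonneg bdd_meas_integrable[OF \<beta>1]) auto
    then show ?thesis
      using primitive_increment[OF primitive_\<sigma> that] by simp
  qed
  have range: "\<sigma> t \<in> {0..\<sigma> T}" if "t \<in> {0..T}" for t
    using mono[of 0 t] mono[of t T] \<sigma>_0 that by auto
  have "primitive T (\<lambda>t. integral {0..\<sigma> t} ?F) (\<lambda>t. ?F (\<sigma> t) * \<beta>1 t)"
    by (rule primitive_chain[OF primitive_\<sigma> range integral_has_real_derivative])
      (use continuous_on_subset[OF contF subset_UNIV] in auto)
  then have "integral {0..\<sigma> T} ?F - integral {0..\<sigma> 0} ?F = integral {0..T} (\<lambda>t. ?F (\<sigma> t) * \<beta>1 t)"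
    using T unfolding primitive_def by auto
  moreover have "(\<lambda>t. ?F (\<sigma> t) * \<beta>1 t) = (\<lambda>t. entry t * F (\<sigma> t))"
    by (auto simp: entry_def)
  moreover have "integral {0..\<sigma> T} ?F = integral {0..M} ?F"
    using F M range[of T] T by (intro integral_truncate contF) auto
  ultimately show ?thesis
    by (simp add: \<sigma>_0)
qed

lemma closed_forms:
  assumes nonneg: "\<And>t. t \<in> {0..T} \<Longrightarrow> 0 \<le> \<beta>1 t"
    and z: "(S, a, b, \<Lambda>) \<in> Z2 M" and \<sigma>T: "\<sigma> T = S"
    and G: "\<And>t. t \<in> {0..T} \<Longrightarrow> G t = residual_beta2 a b (\<sigma> t)"
  shows "integral {0..T} (\<lambda>t. entry t * capped_mean s2 (G t)) = lower_service_form K s2 M a b"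
    and "(\<Sum>k=1..K. x k T) = alive_form K s2 M (S, a, b, \<Lambda>)"
    and "(\<Sum>k=s2+1..K. x k T) = upper_form K s2 (S, a, b, \<Lambda>)"
    and "(\<And>t. t \<in> {0..T} \<Longrightarrow> D t = residual_alpha S a b \<Lambda> (\<sigma> t)) \<Longrightarrow>
      integral {0..T} (\<lambda>t. entry t * capped_mean s2 (G t))
       + D 0 - integral {0..T} (\<lambda>t. entry t * D t) = alpha_service_form K s2 M (S, a, b, \<Lambda>)"
    and "(\<And>t. t \<in> {0..T} \<Longrightarrow> D t = max 0 (S - \<sigma> t)) \<Longrightarrow>
      integral {0..T} (\<lambda>t. entry t * capped_mean s2 (G t))
       + D 0 - integral {0..T} (\<lambda>t. entry t * D t) = full_service_form K s2 M (S, a, b, \<Lambda>)"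
proof -
  have z': "0 \<le> a" "a \<le> b" "b \<le> S" "S \<le> M" "b - a \<le> \<Lambda>" "\<Lambda> \<le> S"
    using z by (auto simp: Z2_def)
  have M: "\<sigma> T \<le> M"
    using z' \<sigma>T by simp
  have res0: "residual_beta2 a b s = 0" if "S \<le> s" for s
    using that z' by (auto simp: residual_beta2_def)
  have late0: "residual_alpha S a b \<Lambda> s = 0" if "S \<le> s" for s
    using that z' by (auto simp: residual_alpha_def res0)
  have ent: "integral {0..T} (\<lambda>t. entry t * f t) = integral {0..M} (\<lambda>s. pois (K - s2 - 1) s * F s)"
    if "continuous_on UNIV F" "\<And>s. S \<le> s \<Longrightarrow> F s = 0" "\<And>t. t \<in> {0..T} \<Longrightarrow> f t = F (\<sigma> t)" for f F
  proof -
    have "integral {0..T} (\<lambda>t. entry t * f t) = integral {0..T} (\<lambda>t. entry t * F (\<sigma> t))"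
      using that by (intro Henstock_Kurzweil_Integration.integral_cong) auto
    then show ?thesis
      using entry_integral[OF nonneg M that(1)] that(2) \<sigma>T by simp
  qed
  have comp: "continuous_on UNIV (\<lambda>s. f (residual_beta2 a b s))" if "continuous_on UNIV f" for f :: "real \<Rightarrow> real"
    using continuous_on_compose2[OF that continuous_residual_beta2] by simp
  show J: "integral {0..T} (\<lambda>t. entry t * capped_mean s2 (G t)) = lower_service_form K s2 M a b"
    unfolding lower_service_form_def
    by (rule ent) (auto simp: res0 capped_mean_at_0 G intro!: comp continuous_on_capped_mean)
  have "integral {0..T} (\<lambda>t. entry t * (1 - pois_less s2 (G t)))
      = integral {0..M} (\<lambda>s. pois (K - s2 - 1) s * (1 - pois_less s2 (residual_beta2 a b s)))"
    by (rule ent) (use s2 in \<open>auto simp: res0 pois_less_at_0 G intro!: comp continuous_intros continuous_on_pois_less\<close>)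
  then show "(\<Sum>k=1..K. x k T) = alive_form K s2 M (S, a, b, \<Lambda>)"
    by (simp add: alive_eq[simplified])
  show "(\<Sum>k=s2+1..K. x k T) = upper_form K s2 (S, a, b, \<Lambda>)"
    using upper_sum[of T] T \<sigma>T by simp
  show "integral {0..T} (\<lambda>t. entry t * capped_mean s2 (G t))
       + D 0 - integral {0..T} (\<lambda>t. entry t * D t) = alpha_service_form K s2 M (S, a, b, \<Lambda>)"
    if D: "\<And>t. t \<in> {0..T} \<Longrightarrow> D t = residual_alpha S a b \<Lambda> (\<sigma> t)"
  proof -
    have "D 0 = \<Lambda>"
      using D[of 0] T z' by (simp add: \<sigma>_0 residual_alpha_def residual_beta2_def)
    moreover have "integral {0..T} (\<lambda>t. entry t * D t)
      = integral {0..M} (\<lambda>s. pois (K - s2 - 1) s * residual_alpha S a b \<Lambda> s)"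
      by (rule ent) (use D in \<open>auto simp: late0 intro!: continuous_residual_alpha\<close>)
    ultimately show ?thesis
      using J by simp
  qed
  show "integral {0..T} (\<lambda>t. entry t * capped_mean s2 (G t))
       + D 0 - integral {0..T} (\<lambda>t. entry t * D t) = full_service_form K s2 M (S, a, b, \<Lambda>)"
    if D: "\<And>t. t \<in> {0..T} \<Longrightarrow> D t = max 0 (S - \<sigma> t)"
  proof -
    have "D 0 = S"
      using D[of 0] T z' by (simp add: \<sigma>_0)
    moreover have "integral {0..T} (\<lambda>t. entry t * D t)
      = integral {0..M} (\<lambda>s. pois (K - s2 - 1) s * max 0 (S - s))"
      by (rule ent) (use D in \<open>auto intro!: continuous_intros\<close>)
    ultimately show ?thesis
      using J by simp
  qed
qed

end

section \<open>Values of the interval policies\<close>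

lemma integral_scaled_indicator:
  fixes t T p q M :: real
  assumes "t \<le> T" "0 < M"
  shows "(\<lambda>u. M * indicator {p/M..q/M} u) integrable_on {t..T}"
    and "integral {t..T} (\<lambda>u. M * indicator {p/M..q/M} u) = max 0 (min (M * T) q - max (M * t) p)"
proof -
  have Int: "{t..T} \<inter> {p/M..q/M} = {max t (p/M)..min T (q/M)}"
    by auto
  have eq: "(\<lambda>u. M * indicator {p/M..q/M} u) = (\<lambda>u. if u \<in> {p/M..q/M} then M else 0)"
    by (auto simp: indicator_def)
  show "(\<lambda>u. M * indicator {p/M..q/M} u) integrable_on {t..T}"
    unfolding eq integrable_restrict_Int Int_commute[of "{p/M..q/M}"] Int
    by (rule integrable_const_ivl)
  have "integral {t..T} (\<lambda>u. M * indicator {p/M..q/M} u)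
      = integral {max t (p/M)..min T (q/M)} (\<lambda>_. M)"
    unfolding eq by (simp only: Henstock_Kurzweil_Integration.integral_restrict_Int Int Int_commute)
  also have "\<dots> = max 0 (M * (min T (q/M) - max t (p/M)))"
    using assms by (cases "max t (p/M) \<le> min T (q/M)")
      (auto simp: mult.commute max_def[of 0] mult_le_0_iff zero_le_mult_iff not_le)
  also have "M * (min T (q/M) - max t (p/M)) = min (M * T) q - max (M * t) p"
    using assms by (auto simp: min_def max_def field_simps)
  finally show "integral {t..T} (\<lambda>u. M * indicator {p/M..q/M} u) = max 0 (min (M * T) q - max (M * t) p)" .
qed

lemma bdd_meas_scaled_indicator: "bdd_meas T (\<lambda>u. M * indicator {p..q} u)"
proof (rule bdd_measI)
  show "(\<lambda>u. M * indicator {p..q} u) \<in> borel_measurable (lebesgue_on {0..T})"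
    by (intro borel_measurable_times borel_measurable_const measurable_restrict_space1
          borel_measurable_indicator) auto
  show "\<bar>M * indicator {p..q} t\<bar> \<le> \<bar>M\<bar>" for t
    by (auto simp: indicator_def)
qed

lemma beta2z_eq: "beta2z M (S, a, b, \<Lambda>) = (\<lambda>t. M * indicator {a/M..b/M} t)"
  by auto

text \<open>In the second case the two intervals are disjoint, so the indicator of the union is a sum.\<close>

lemma alphaz_eq:
  assumes "M > 0"
  shows "alphaz M (S, a, b, \<Lambda>) =
    (if S - \<Lambda> \<le> a then (\<lambda>t. M * indicator {(S - \<Lambda>)/M..S/M} t)
     else (\<lambda>t. M * indicator {a/M..b/M} t + M * indicator {(S - \<Lambda> + b - a)/M..S/M} t))"
proof -
  have "indicator ({a/M..b/M} \<union> {(S - \<Lambda> + b - a)/M..S/M}) t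
      = (indicator {a/M..b/M} t + indicator {(S - \<Lambda> + b - a)/M..S/M} t :: real)"
    if "\<not> S - \<Lambda> \<le> a" for t
    using that assms by (auto simp: indicator_def field_simps)
  then show ?thesis
    by (auto simp: fun_eq_iff algebra_simps)
qed

lemma bdd_meas_beta2z: "bdd_meas T (beta2z M z)"
  by (cases z) (simp add: beta2z_eq bdd_meas_scaled_indicator)

lemma bdd_meas_alphaz: "M > 0 \<Longrightarrow> bdd_meas T (alphaz M z)"
  by (cases z) (auto simp: alphaz_eq bdd_meas_scaled_indicator intro!: bdd_meas_add)

text \<open>The horizon may exceed \<open>S/M\<close> if all rates vanish afterwards. The case \<open>T = S/M\<close> gives the functions
  \<open>R1\<close> to \<open>R4\<close>, the case \<open>T = 1\<close> the values of the same policy in the original problem. The values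
  for the full rate \<open>\<beta>1\<close> arise from those for \<open>\<alpha>\<close> by taking \<open>\<alpha> = \<beta>1\<close>.\<close>

lemma interval_policy_values:
  assumes s2: "1 \<le> s2" "s2 < K" and M: "M > 0"
    and z: "z = (S, a, b, \<Lambda>)" "z \<in> Z2 M" and T: "S/M \<le> T"
    and \<beta>1: "\<And>t. t \<in> {0..T} \<Longrightarrow> \<beta>1 t = M * indicator {0..S/M} t"
    and sol: "is_solution K s2 T \<beta>1 (beta2z M z) x"
  shows "(\<Sum>k=1..K. x k T) = alive_form K s2 M z"
    and "(\<Sum>k=s2+1..K. x k T) = upper_form K s2 z"
    and "(LINT t:{0..T}|lebesgue.
        beta2z M z t * (\<Sum>k=1..s2. x k t) + alphaz M z t * (\<Sum>k=s2+1..K. x k t)) = alpha_service_form K s2 M z"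
    and "(LINT t:{0..T}|lebesgue.
        beta2z M z t * (\<Sum>k=1..s2. x k t) + \<beta>1 t * (\<Sum>k=s2+1..K. x k t)) = full_service_form K s2 M z"
    and "(\<Sum>k=1..s2. LINT t:{0..T}|lebesgue. beta2z M z t * x k t) +
        (\<Sum>k=s2+1..K. LINT t:{0..T}|lebesgue. alphaz M z t * x k t) = alpha_service_form K s2 M z"
    and "(\<Sum>k=1..s2. LINT t:{0..T}|lebesgue. beta2z M z t * x k t) +
        (\<Sum>k=s2+1..K. LINT t:{0..T}|lebesgue. \<beta>1 t * x k t) = full_service_form K s2 M z"
    and "(LINT t:{0..T}|lebesgue. alphaz M z t) = \<Lambda>"
proof -
  have z': "0 \<le> a" "a \<le> b" "b \<le> S" "S \<le> M" "b - a \<le> \<Lambda>" "\<Lambda> \<le> S"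
    using z by (auto simp: Z2_def)
  have T0: "0 \<le> T"
    using T M z' by (smt (verit) divide_nonneg_pos)
  have MT: "S \<le> M * T"
    using T M by (simp add: pos_divide_le_eq mult.commute)
  have b\<beta>1: "bdd_meas T \<beta>1"
    by (rule bdd_meas_cong[OF \<beta>1[symmetric] bdd_meas_scaled_indicator])
  note b\<alpha> = bdd_meas_alphaz[OF M, of T z]
  interpret A: controlled_chain K s2 T \<beta>1 "beta2z M z" "alphaz M z" x
    using s2 T0 b\<beta>1 b\<alpha> bdd_meas_beta2z sol by unfold_locales auto
  interpret B: controlled_chain K s2 T \<beta>1 "beta2z M z" \<beta>1 x
    using s2 T0 b\<beta>1 bdd_meas_beta2z sol by unfold_locales auto
  have int\<beta>1: "integral {t..t'} \<beta>1 = max 0 (min (M * t') S - M * t)"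
    if "0 \<le> t" "t \<le> t'" "t' \<le> T" for t t'
  proof -
    have "integral {t..t'} \<beta>1 = integral {t..t'} (\<lambda>u. M * indicator {0/M..S/M} u)"
      using that \<beta>1 by (intro Henstock_Kurzweil_Integration.integral_cong) auto
    then show ?thesis
      using that M by (subst (asm) integral_scaled_indicator) auto
  qed
  have \<sigma>: "integral {0..t} \<beta>1 = min (M * t) S" if "t \<in> {0..T}" for t
    using int\<beta>1[of 0 t] that z' M by (auto simp: min_def max_def)
  have A\<sigma>: "A.\<sigma> t = min (M * t) S" and B\<sigma>: "B.\<sigma> t = min (M * t) S" if "t \<in> {0..T}" for t
    using \<sigma> that by (simp_all add: A.\<sigma>_def B.\<sigma>_def)
  have res: "integral {t..T} (beta2z M z) = residual_beta2 a b (min (M * t) S)" if "t \<in> {0..T}" for t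
  proof -
    have "integral {t..T} (beta2z M z) = max 0 (min (M * T) b - max (M * t) a)"
      unfolding z(1) beta2z_eq using that M by (intro integral_scaled_indicator) auto
    then show ?thesis
      using z' MT by (auto simp: residual_beta2_def min_def max_def)
  qed
  have late: "integral {t..T} (alphaz M z) = residual_alpha S a b \<Lambda> (min (M * t) S)" if t: "t \<in> {0..T}" for t
  proof (cases "S - \<Lambda> \<le> a")
    case True
    then have "alphaz M z = (\<lambda>t. M * indicator {(S - \<Lambda>)/M..S/M} t)"
      using M by (simp add: z(1) alphaz_eq)
    then have "integral {t..T} (alphaz M z) = max 0 (min (M * T) S - max (M * t) (S - \<Lambda>))"
      using t M by (simp only:) (intro integral_scaled_indicator; simp)
    then have "integral {t..T} (alphaz M z) = max 0 (S - max (M * t) (S - \<Lambda>))"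
      using MT by simp
    then show ?thesis
      unfolding residual_alpha_def residual_beta2_def using True z' by (auto simp: min_def max_def)
  next
    case False
    then have "integral {t..T} (alphaz M z)
        = integral {t..T} (\<lambda>t. M * indicator {a/M..b/M} t)
          + integral {t..T} (\<lambda>t. M * indicator {(S - \<Lambda> + b - a)/M..S/M} t)"
      using t M integral_scaled_indicator(1)[of t T M a b]
        integral_scaled_indicator(1)[of t T M "S - \<Lambda> + b - a" S]
      by (simp add: z(1) alphaz_eq Henstock_Kurzweil_Integration.integral_add)
    also have "\<dots> = max 0 (min (M * T) b - max (M * t) a)
        + max 0 (min (M * T) S - max (M * t) (S - \<Lambda> + b - a))"
      using t M by (intro arg_cong2[where f = "(+)"] integral_scaled_indicator) auto
    also have "\<dots> = max 0 (b - max (M * t) a) + max 0 (S - max (M * t) (S - \<Lambda> + b - a))"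
      using MT z' by simp
    finally show ?thesis
      unfolding residual_alpha_def residual_beta2_def using False z' by (auto simp: min_def max_def)
  qed
  have nonneg: "0 \<le> \<beta>1 t" if "t \<in> {0..T}" for t
    using \<beta>1[OF that] M by (simp add: indicator_def)
  have AT: "A.\<sigma> T = S" and BT: "B.\<sigma> T = S"
    using A\<sigma>[of T] B\<sigma>[of T] T0 MT by auto
  have AG: "A.G t = residual_beta2 a b (A.\<sigma> t)" and BG: "B.G t = residual_beta2 a b (B.\<sigma> t)"
    if "t \<in> {0..T}" for t
    using res[OF that] A\<sigma>[OF that] B\<sigma>[OF that] by (simp_all add: A.G_def B.G_def)
  have AD: "A.D t = residual_alpha S a b \<Lambda> (A.\<sigma> t)" if "t \<in> {0..T}" for t
    using late[OF that] A\<sigma>[OF that] by (simp add: A.D_def)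
  have BD: "B.D t = max 0 (S - B.\<sigma> t)" if "t \<in> {0..T}" for t
    using int\<beta>1[of t T] that B\<sigma>[OF that] MT by (auto simp: B.D_def)
  note Z = z(2)[unfolded z(1)]
  note ZA = A.closed_forms[OF nonneg Z AT AG, folded z(1)]
    and ZB = B.closed_forms[OF nonneg Z BT BG, folded z(1)]
  show "(\<Sum>k=1..K. x k T) = alive_form K s2 M z" "(\<Sum>k=s2+1..K. x k T) = upper_form K s2 z"
    by (rule ZA; assumption)+
  show "(LINT t:{0..T}|lebesgue.
        beta2z M z t * (\<Sum>k=1..s2. x k t) + alphaz M z t * (\<Sum>k=s2+1..K. x k t)) = alpha_service_form K s2 M z"
    "(\<Sum>k=1..s2. LINT t:{0..T}|lebesgue. beta2z M z t * x k t) +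
        (\<Sum>k=s2+1..K. LINT t:{0..T}|lebesgue. alphaz M z t * x k t) = alpha_service_form K s2 M z"
    unfolding A.service_eq by (rule ZA(4)[OF _ _ AD]; assumption)+
  show "(LINT t:{0..T}|lebesgue.
        beta2z M z t * (\<Sum>k=1..s2. x k t) + \<beta>1 t * (\<Sum>k=s2+1..K. x k t)) = full_service_form K s2 M z"
    "(\<Sum>k=1..s2. LINT t:{0..T}|lebesgue. beta2z M z t * x k t) +
        (\<Sum>k=s2+1..K. LINT t:{0..T}|lebesgue. \<beta>1 t * x k t) = full_service_form K s2 M z"
    unfolding B.service_eq by (rule ZB(5)[OF _ _ BD]; assumption)+
  have "(LINT t:{0..T}|lebesgue. alphaz M z t) = integral {0..T} (alphaz M z)"
    using T0 by (intro bdd_meas_set_integral[OF b\<alpha>]) auto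
  also have "\<dots> = \<Lambda>"
    using late[of 0] T0 z' by (simp add: residual_alpha_def residual_beta2_def)
  finally show "(LINT t:{0..T}|lebesgue. alphaz M z t) = \<Lambda>" .
qed

lemma R_eq_closed_form:
  assumes s2: "1 \<le> s2" "s2 < K" and M: "M > 0" and z: "z \<in> Z2 M"
  shows "R1 K s2 M z = alive_form K s2 M z" "R2 K s2 M z = upper_form K s2 z"
    "R3 K s2 M z = alpha_service_form K s2 M z" "R4 K s2 M z = full_service_form K s2 M z"
proof -
  obtain S a b \<Lambda> where zeq: "z = (S, a, b, \<Lambda>)"
    by (cases z)
  have hor: "horizon M z = S / M"
    by (simp add: zeq)
  have "\<exists>x. is_solution K s2 (S/M) (\<lambda>_. M) (beta2z M z) x"
    by (intro solution_exists s2 bdd_meas_const bdd_meas_beta2z)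
  then have "is_solution K s2 (S/M) (\<lambda>_. M) (beta2z M z) (xz K s2 M z)"
    unfolding xz_def hor by (rule someI_ex)
  note vals = interval_policy_values[OF s2 M zeq z order_refl _ this]
  show "R1 K s2 M z = alive_form K s2 M z" "R2 K s2 M z = upper_form K s2 z"
    "R3 K s2 M z = alpha_service_form K s2 M z" "R4 K s2 M z = full_service_form K s2 M z"
    unfolding R1_def R2_def R3_def R4_def hor by (rule vals; simp)+
qed

section \<open>Interval policies dominate\<close>

lemma primitive_mono:
  assumes F: "primitive T F f" and G: "primitive T G g"
    and le: "\<And>u. u \<in> {0..T} \<Longrightarrow> f u \<le> g u" and st: "0 \<le> s" "s \<le> t" "t \<le> T"
  shows "F t - F s \<le> G t - G s"
  unfolding primitive_increment[OF F st] primitive_increment[OF G st]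
  using st le
  by (intro integral_le bdd_meas_integrable[OF primitive_bdd_meas[OF F]]
      bdd_meas_integrable[OF primitive_bdd_meas[OF G]]) auto

lemma continuous_parametric_integral:
  fixes F :: "'a::metric_space \<Rightarrow> real \<Rightarrow> real"
  assumes "continuous_on UNIV (\<lambda>p. F (fst p) (snd p))"
  shows "continuous_on UNIV (\<lambda>z. integral {0..M} (F z))"
proof -
  have "continuous_on (UNIV \<times> cbox 0 M) (\<lambda>(z, s). F z s)"
    using continuous_on_subset[OF assms subset_UNIV] by (simp add: case_prod_beta)
  then show ?thesis
    using integral_continuous_on_param[of UNIV 0 M F] by simp
qed

lemma continuous_compose_UNIV:
  "continuous_on UNIV f \<Longrightarrow> continuous_on X g \<Longrightarrow> continuous_on X (\<lambda>p. f (g p))"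
  by (rule continuous_on_compose2[of UNIV f]) auto

lemma continuous_lower_service_form:
  fixes f g :: "'a::metric_space \<Rightarrow> real"
  assumes [continuous_intros]: "continuous_on UNIV f" "continuous_on UNIV g"
  shows "continuous_on UNIV (\<lambda>z. lower_service_form K s2 M (f z) (g z))"
  unfolding lower_service_form_def residual_beta2_def
  by (intro continuous_parametric_integral continuous_intros
      continuous_compose_UNIV[OF continuous_on_pois] continuous_compose_UNIV[OF continuous_on_capped_mean]
      continuous_compose_UNIV[OF assms(1)] continuous_compose_UNIV[OF assms(2)])

lemma continuous_closed_forms:
  "continuous_on UNIV (alive_form K s2 M)" "continuous_on UNIV (upper_form K s2)"
  "continuous_on UNIV (alpha_service_form K s2 M)" "continuous_on UNIV (full_service_form K s2 M)"
proof -
  have eq: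
    "alive_form K s2 M = (\<lambda>z. 1 - integral {0..M} (\<lambda>s. pois (K - s2 - 1) s *
       (1 - pois_less s2 (residual_beta2 (fst (snd z)) (fst (snd (snd z))) s))))"
    "upper_form K s2 = (\<lambda>z. pois_less (K - s2) (fst z))"
    "alpha_service_form K s2 M = (\<lambda>z. lower_service_form K s2 M (fst (snd z)) (fst (snd (snd z))) + snd (snd (snd z))
       - integral {0..M} (\<lambda>s. pois (K - s2 - 1) s *
           residual_alpha (fst z) (fst (snd z)) (fst (snd (snd z))) (snd (snd (snd z))) s))"
    "full_service_form K s2 M = (\<lambda>z. lower_service_form K s2 M (fst (snd z)) (fst (snd (snd z))) + fst z
       - integral {0..M} (\<lambda>s. pois (K - s2 - 1) s * max 0 (fst z - s)))"
    by (auto simp: fun_eq_iff)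
  show "continuous_on UNIV (alive_form K s2 M)" "continuous_on UNIV (upper_form K s2)"
    "continuous_on UNIV (alpha_service_form K s2 M)" "continuous_on UNIV (full_service_form K s2 M)"
    unfolding eq residual_alpha_def residual_beta2_def
    by (intro continuous_intros continuous_lower_service_form continuous_parametric_integral
        continuous_compose_UNIV[OF continuous_on_pois] continuous_compose_UNIV[OF continuous_on_pois_less])+
qed

context controlled_chain
begin

text \<open>The single-crossing argument. Only \<open>a\<close> is free: \<open>S\<close>, \<open>B\<close> and \<open>\<Lambda>\<close> are kept, and \<open>a\<close> is chosen such
  that the lower block receives the same amount of service. The full-rate service then has the same
  value, while the survivors and the service counted by \<open>\<alpha>\<close> do not increase.\<close>

lemma interval_policy_dominates:
  assumes order: "\<And>t. t \<in> {0..T} \<Longrightarrow> 0 \<le> \<beta>2 t \<and> \<beta>2 t \<le> \<alpha> t \<and> \<alpha> t \<le> \<beta>1 t"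
    and M: "\<sigma> T \<le> M"
  shows "\<exists>a b. (\<sigma> T, a, b, D 0) \<in> Z2 M
    \<and> integral {0..T} (\<lambda>t. entry t * capped_mean s2 (G t)) = lower_service_form K s2 M a b
    \<and> alive_form K s2 M (\<sigma> T, a, b, D 0) \<le> (\<Sum>k=1..K. x k T)
    \<and> alpha_service_form K s2 M (\<sigma> T, a, b, D 0) \<le> integral {0..T} (\<lambda>t. entry t * capped_mean s2 (G t))
         + D 0 - integral {0..T} (\<lambda>t. entry t * D t)"
proof -
  define S where "S = \<sigma> T"
  define B where "B = G 0"
  define \<Lambda> where "\<Lambda> = D 0"
  have o: "0 \<le> \<beta>2 t" "\<beta>2 t \<le> \<alpha> t" "\<alpha> t \<le> \<beta>1 t" "\<beta>2 t \<le> \<beta>1 t" "0 \<le> \<alpha> t" "0 \<le> \<beta>1 t"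
    if "t \<in> {0..T}" for t
    using order[OF that] by auto
  have \<sigma>_mono: "\<sigma> s \<le> \<sigma> t" if "0 \<le> s" "s \<le> t" "t \<le> T" for s t
    using primitive_mono[OF primitive_const[of T 0] primitive_\<sigma> _ that] o by auto
  have G_anti: "G t \<le> G s" if "0 \<le> s" "s \<le> t" "t \<le> T" for s t
    using primitive_mono[OF primitive_G primitive_const[of T 0] _ that] o by auto
  have G\<sigma>: "G s - G t \<le> \<sigma> t - \<sigma> s" if "0 \<le> s" "s \<le> t" "t \<le> T" for s t
    using primitive_mono[OF primitive_cmult[OF primitive_G, of "-1"] primitive_\<sigma> _ that] o by auto
  have D\<sigma>: "D s - D t \<le> \<sigma> t - \<sigma> s" if "0 \<le> s" "s \<le> t" "t \<le> T" for s t
    using primitive_mono[OF primitive_cmult[OF primitive_D, of "-1"] primitive_\<sigma> _ that] o by auto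
  have GD: "G s - G t \<le> D s - D t" if "0 \<le> s" "s \<le> t" "t \<le> T" for s t
    using primitive_mono[OF primitive_D primitive_G _ that] o by auto
  have \<sigma>_range: "0 \<le> \<sigma> t" "\<sigma> t \<le> S" if "t \<in> {0..T}" for t
    using \<sigma>_mono[of 0 t] \<sigma>_mono[of t T] \<sigma>_0 that by (auto simp: S_def)
  have G_range: "0 \<le> G t" "G t \<le> B" "B - \<sigma> t \<le> G t" "G t \<le> S - \<sigma> t" if "t \<in> {0..T}" for t
    using G_anti[of 0 t] G_anti[of t T] G\<sigma>[of 0 t] G\<sigma>[of t T] \<sigma>_0 G_T that
    by (auto simp: S_def B_def)
  have D_range: "D t \<le> S - \<sigma> t" "D t \<le> \<Lambda> - B + G t" if "t \<in> {0..T}" for t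
    using D\<sigma>[of t T] GD[of 0 t] D_T that by (auto simp: S_def B_def \<Lambda>_def)
  have BS: "0 \<le> B" "B \<le> \<Lambda>" "\<Lambda> \<le> S" "0 \<le> S" "S \<le> M"
    using G_range[of 0] GD[of 0 T] D\<sigma>[of 0 T] \<sigma>_range[of T] T G_T D_T \<sigma>_0 M
    by (auto simp: B_def \<Lambda>_def S_def)
  have entry_nonneg: "0 \<le> entry t" if "t \<in> {0..T}" for t
    using o[OF that] \<sigma>_range[OF that] by (simp add: entry_def pois_nonneg)
  have ent: "bdd_meas T (\<lambda>t. entry t * f t)" if "continuous_on {0..T} f" for f
    by (intro bdd_meas_mult bdd_meas_entry bdd_meas_continuous that)
  have entry_le: "integral {0..T} (\<lambda>t. entry t * f t) \<le> integral {0..T} (\<lambda>t. entry t * g t)"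
    if "continuous_on {0..T} f" "continuous_on {0..T} g" "\<And>t. t \<in> {0..T} \<Longrightarrow> f t \<le> g t" for f g
    using that T entry_nonneg
    by (intro integral_le bdd_meas_integrable[OF ent] mult_left_mono) auto
  have cG: "continuous_on {0..T} (\<lambda>t. f (G t))" if "continuous_on UNIV f" for f :: "real \<Rightarrow> real"
    by (rule continuous_compose_UNIV[OF that primitive_continuous[OF primitive_G]])
  have c\<sigma>: "continuous_on {0..T} (\<lambda>t. f (\<sigma> t))" if "continuous_on UNIV f" for f :: "real \<Rightarrow> real"
    by (rule continuous_compose_UNIV[OF that primitive_continuous[OF primitive_\<sigma>]])
  have cR: "continuous_on {0..T} (\<lambda>t. f (residual_beta2 a b (\<sigma> t)))" if "continuous_on UNIV f"
    for f :: "real \<Rightarrow> real" and a b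
    by (rule continuous_compose_UNIV[OF that c\<sigma>[OF continuous_residual_beta2]])
  have res0: "residual_beta2 a (a + B) s = 0" if "a \<le> S - B" "S \<le> s" for a s
    using that BS by (auto simp: residual_beta2_def)
  have trans: "integral {0..M} (\<lambda>s. pois (K - s2 - 1) s * f (residual_beta2 a (a + B) s))
      = integral {0..T} (\<lambda>t. entry t * f (residual_beta2 a (a + B) (\<sigma> t)))"
    if "continuous_on UNIV f" "f 0 = 0" "a \<le> S - B" for a and f :: "real \<Rightarrow> real"
    by (rule entry_integral[symmetric])
      (use that M o continuous_compose_UNIV[OF that(1) continuous_residual_beta2] in \<open>auto simp: res0 S_def[symmetric]\<close>)
  define j where "j = integral {0..T} (\<lambda>t. entry t * capped_mean s2 (G t))"
  have j_eq: "lower_service_form K s2 M a (a + B) = integral {0..T} (\<lambda>t. entry t * capped_mean s2 (residual_beta2 a (a + B) (\<sigma> t)))"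
    if "a \<le> S - B" for a
    unfolding lower_service_form_def by (rule trans[OF continuous_on_capped_mean capped_mean_at_0 that])
  have res_nonneg: "0 \<le> residual_beta2 a (a + B) s" for a s
    using BS by (simp add: residual_beta2_def)

  \<comment> \<open>Serving the lower block at once exhausts its clock as early as possible, serving it at the end
    as late as possible; every residual clock \<open>G\<close> lies between the two.\<close>
  have "lower_service_form K s2 M 0 (0 + B) \<le> j"
    unfolding j_def using BS
    by (subst j_eq, simp, intro entry_le cR cG continuous_on_capped_mean capped_mean_mono res_nonneg)
      (use G_range(1,3) in \<open>auto simp: residual_beta2_def min_le_iff_disj\<close>)
  moreover have "j \<le> lower_service_form K s2 M (S - B) (S - B + B)"
    unfolding j_def using BS G_range
    by (subst j_eq, simp, intro entry_le cR cG continuous_on_capped_mean capped_mean_mono)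
      (auto simp: residual_beta2_def le_max_iff_disj)
  moreover have "continuous_on {0..S - B} (\<lambda>a. lower_service_form K s2 M a (a + B))"
    by (intro continuous_on_subset[OF continuous_lower_service_form subset_UNIV] continuous_intros)
  ultimately obtain a where a: "0 \<le> a" "a \<le> S - B" "lower_service_form K s2 M a (a + B) = j"
    using IVT'[of "\<lambda>a. lower_service_form K s2 M a (a + B)" 0 j "S - B"] BS by auto
  define b where "b = a + B"
  define R where "R t = residual_beta2 a b (\<sigma> t)" for t
  have jR: "integral {0..T} (\<lambda>t. entry t * capped_mean s2 (R t)) = j"
    using j_eq[OF a(2)] a(3) by (simp add: R_def b_def)

  \<comment> \<open>At the crossing time \<open>t0\<close> the residual clock \<open>G\<close> meets the descending line \<open>b - \<sigma>\<close>; the sum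
    \<open>\<sigma> + G\<close> is nondecreasing, so \<open>G\<close> stays below the line before \<open>t0\<close> and above it afterwards.\<close>
  have "continuous_on {0..T} (\<lambda>t. \<sigma> t + G t)"
    by (intro continuous_intros primitive_continuous[OF primitive_\<sigma>] primitive_continuous[OF primitive_G])
  then obtain t0 where t0: "0 \<le> t0" "t0 \<le> T" "\<sigma> t0 + G t0 = b"
    using IVT'[of "\<lambda>t. \<sigma> t + G t" 0 b T] a T \<sigma>_0 G_T by (auto simp: b_def B_def S_def)
  define g0 where "g0 = G t0"
  have g0: "0 \<le> g0" "g0 \<le> B"
    using G_range[of t0] t0 by (auto simp: g0_def)
  have before: "g0 \<le> G t \<and> G t \<le> R t" if "t \<in> {0..T}" "t \<le> t0" for t
    using G_anti[of t t0] G\<sigma>[of t t0] G_range[OF that(1)] that t0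
    by (auto simp: g0_def R_def residual_beta2_def b_def)
  have after: "R t \<le> G t \<and> G t \<le> g0" "R t = max 0 (b - \<sigma> t)" if "t \<in> {0..T}" "t0 \<le> t" for t
    using G_anti[of t0 t] G\<sigma>[of t0 t] G_range[OF that(1)] that t0 \<sigma>_mono[of t0 t] g0 BS
    by (auto simp: g0_def R_def residual_beta2_def b_def)
  have cross: "g0 \<le> G t \<and> G t \<le> R t \<or> R t \<le> G t \<and> G t \<le> g0" if "t \<in> {0..T}" for t
    using before[OF that] after(1)[OF that] by linarith
  have R_nonneg: "0 \<le> R t" for t
    unfolding R_def b_def by (rule res_nonneg)

  have dominate: "integral {0..T} (\<lambda>t. entry t * \<psi> (G t)) \<le> integral {0..T} (\<lambda>t. entry t * \<psi> (R t))"
    if deriv: "\<And>c. (\<psi> has_real_derivative \<psi>' c) (at c)"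
      and mono: "\<And>g c. 0 \<le> g \<Longrightarrow> g \<le> c \<Longrightarrow> \<psi>' g * pois_less s2 c \<le> \<psi>' c * pois_less s2 g" for \<psi> \<psi>'
  proof -
    have c\<psi>: "continuous_on UNIV \<psi>"
      using deriv by (intro DERIV_continuous_on) auto
    let ?I = "\<lambda>f. integral {0..T} (\<lambda>t. entry t * f t)"
    have lin: "?I (\<lambda>t. c * (f (R t) - f (G t))) = c * (?I (\<lambda>t. f (R t)) - ?I (\<lambda>t. f (G t)))"
      if f: "continuous_on UNIV f" for f c
    proof -
      have "?I (\<lambda>t. f (R t)) - ?I (\<lambda>t. f (G t)) = integral {0..T} (\<lambda>t. entry t * f (R t) - entry t * f (G t))"
        unfolding R_def using T by (intro integral_diff_on[symmetric, where T = T] ent cR[OF f] cG[OF f]) auto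
      then show ?thesis
        by (simp add: Henstock_Kurzweil_Integration.integral_mult_right[symmetric] algebra_simps
            del: Henstock_Kurzweil_Integration.integral_mult_right)
    qed
    have "?I (\<lambda>t. \<psi>' g0 * (capped_mean s2 (R t) - capped_mean s2 (G t)))
        \<le> ?I (\<lambda>t. pois_less s2 g0 * (\<psi> (R t) - \<psi> (G t)))"
    proof (rule entry_le)
      fix t assume t: "t \<in> {0..T}"
      show "\<psi>' g0 * (capped_mean s2 (R t) - capped_mean s2 (G t)) \<le> pois_less s2 g0 * (\<psi> (R t) - \<psi> (G t))"
        using relative_convex_increment[of \<psi> \<psi>' s2 g0 "R t" "G t"] deriv mono g0 R_nonneg
          G_range(1)[OF t] cross[OF t] by blast
    qed (unfold R_def, (intro continuous_intros cR cG continuous_on_capped_mean c\<psi>)+)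
    then have "0 \<le> pois_less s2 g0 * (?I (\<lambda>t. \<psi> (R t)) - ?I (\<lambda>t. \<psi> (G t)))"
      unfolding lin[OF continuous_on_capped_mean] lin[OF c\<psi>] jR by (simp add: j_def)
    then show ?thesis
      using pois_less_pos[of s2 g0] g0 s2 by (simp add: zero_le_mult_iff)
  qed

  have Z: "(S, a, b, \<Lambda>) \<in> Z2 M"
    using a BS by (auto simp: Z2_def b_def)
  have "integral {0..T} (\<lambda>t. entry t * (1 - pois_less s2 (G t)))
      \<le> integral {0..T} (\<lambda>t. entry t * (1 - pois_less s2 (R t)))"
    by (rule dominate[where \<psi>' = "pois (s2 - 1)"])
      (use s2 hazard_mono[of s2] pois_less_deriv[of s2] in \<open>auto intro!: derivative_eq_intros\<close>)
  also have "\<dots> = integral {0..M} (\<lambda>s. pois (K - s2 - 1) s * (1 - pois_less s2 (residual_beta2 a b s)))"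
    unfolding R_def b_def
    by (rule trans[symmetric])
      (use a s2 in \<open>auto simp: pois_less_at_0 intro!: continuous_intros continuous_on_pois_less\<close>)
  finally have alive_le: "alive_form K s2 M (S, a, b, \<Lambda>) \<le> (\<Sum>k=1..K. x k T)"
    using alive_eq by simp

  have cD: "continuous_on {0..T} D"
    by (rule primitive_continuous[OF primitive_D])
  have late0: "residual_alpha S a b \<Lambda> s = 0" if "S \<le> s" for s
    using that BS a res0[of a s] by (auto simp: residual_alpha_def b_def)
  have late_eq: "integral {0..M} (\<lambda>s. pois (K - s2 - 1) s * residual_alpha S a b \<Lambda> s)
      = integral {0..T} (\<lambda>t. entry t * residual_alpha S a b \<Lambda> (\<sigma> t))"
    by (rule entry_integral[symmetric])
      (use M o in \<open>auto simp: late0 S_def[symmetric] intro!: continuous_residual_alpha\<close>)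
  have "integral {0..T} (\<lambda>t. entry t * D t) \<le> integral {0..T} (\<lambda>t. entry t * residual_alpha S a b \<Lambda> (\<sigma> t))"
  \<comment> \<open>If \<open>S \<le> \<Lambda> - B + b\<close>, the remaining upper clock is already the binding bound at the crossing, and
    the comparison is pointwise. Otherwise it is pointwise up to the difference \<open>R - G\<close>, whose
    integral is nonnegative by single crossing.\<close>
  proof (cases "S \<le> \<Lambda> - B + b")
    case True
    have "D t \<le> residual_alpha S a b \<Lambda> (\<sigma> t)" if t: "t \<in> {0..T}" for t
      using before[OF t] after[OF t] D_range[OF t] True
      unfolding residual_alpha_def R_def[symmetric] by (cases "t \<le> t0") (auto simp: b_def)
    then show ?thesis
      by (intro entry_le cD c\<sigma> continuous_residual_alpha)
  next
    case False
    have "D t + (R t - G t) \<le> residual_alpha S a b \<Lambda> (\<sigma> t)" if t: "t \<in> {0..T}" for t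
    proof -
      have "R t \<le> max 0 (b - \<sigma> t)"
        by (simp add: R_def residual_beta2_def)
      then show ?thesis
        using D_range[OF t] False G_range[OF t] \<sigma>_range[OF t] BS
        unfolding residual_alpha_def R_def[symmetric] by (auto simp: b_def max_def split: if_splits)
    qed
    then have "integral {0..T} (\<lambda>t. entry t * (D t + (R t - G t)))
        \<le> integral {0..T} (\<lambda>t. entry t * residual_alpha S a b \<Lambda> (\<sigma> t))"
      unfolding R_def by (intro entry_le continuous_intros cD c\<sigma> continuous_residual_alpha cR[of "\<lambda>c. c"] cG[of "\<lambda>c. c"])
    moreover have "integral {0..T} (\<lambda>t. entry t * (D t + (R t - G t)))
        = integral {0..T} (\<lambda>t. entry t * D t) + (integral {0..T} (\<lambda>t. entry t * R t)
            - integral {0..T} (\<lambda>t. entry t * G t))"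
    proof -
      have c: "continuous_on {0..T} R" "continuous_on {0..T} G"
        using cR[of "\<lambda>c. c"] cG[of "\<lambda>c. c"] by (simp_all add: R_def)
      have "integral {0..T} (\<lambda>t. entry t * (D t + (R t - G t)))
        = integral {0..T} (\<lambda>t. entry t * D t + (entry t * R t - entry t * G t))"
        by (simp add: algebra_simps)
      also have "\<dots> = integral {0..T} (\<lambda>t. entry t * D t)
          + integral {0..T} (\<lambda>t. entry t * R t - entry t * G t)"
        using T by (intro integral_add_on[where T = T] bdd_meas_diff ent cD c) auto
      also have "integral {0..T} (\<lambda>t. entry t * R t - entry t * G t)
          = integral {0..T} (\<lambda>t. entry t * R t) - integral {0..T} (\<lambda>t. entry t * G t)"
        using T by (intro integral_diff_on[where T = T] ent c) auto
      finally show ?thesis .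
    qed
    moreover have "integral {0..T} (\<lambda>t. entry t * G t) \<le> integral {0..T} (\<lambda>t. entry t * R t)"
      by (rule dominate[of "\<lambda>c. c" "\<lambda>_. 1"]) (auto intro: pois_less_antimono)
    ultimately show ?thesis by linarith
  qed
  then have service_le: "alpha_service_form K s2 M (S, a, b, \<Lambda>) \<le> j + \<Lambda> - integral {0..T} (\<lambda>t. entry t * D t)"
    unfolding alpha_service_form.simps late_eq using a(3) by (simp add: b_def)
  show ?thesis
    using Z alive_le service_le a(3)[folded b_def, symmetric] unfolding j_def S_def \<Lambda>_def by blast
qed

end

section \<open>The finite-dimensional problem\<close>

text \<open>The constraints \<open>Theta z \<le> \<theta>\<close> multiplied out. Unlike the quotients, they depend continuously on
  \<open>(z, \<theta>)\<close> also where \<open>\<Lambda> = 0\<close>.\<close>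

fun certified :: "nat \<Rightarrow> nat \<Rightarrow> real \<Rightarrow> params \<Rightarrow> real \<Rightarrow> bool" where
  "certified K s2 M (S, a, b, \<Lambda>) \<theta> \<longleftrightarrow>
     alive_form K s2 M (S, a, b, \<Lambda>) \<le> \<theta> \<and> upper_form K s2 (S, a, b, \<Lambda>) \<le> \<theta> * pois_less K \<Lambda> \<and>
     alpha_service_form K s2 M (S, a, b, \<Lambda>) \<le> \<theta> * capped_mean K \<Lambda> \<and> full_service_form K s2 M (S, a, b, \<Lambda>) \<le> \<theta> * capped_mean K M"

text \<open>Makes a certified \<open>\<theta>\<close> nonnegative, which settles the third quotient where its denominator is \<open>0\<close>.\<close>

lemma alive_form_nonneg:
  assumes "0 < s2" "s2 < K" "0 \<le> M" "z \<in> Z2 M"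
  shows "0 \<le> alive_form K s2 M z"
proof -
  obtain S a b \<Lambda> where z: "z = (S, a, b, \<Lambda>)" by (cases z)
  have ab: "a \<le> b" using assms z by (auto simp: Z2_def)
  let ?p = "pois (K - s2 - 1)"
  have "(?p has_integral (- pois_less (K - s2) M - - pois_less (K - s2) 0)) {0..M}"
    using assms pois_less_deriv[of "K - s2"]
    by (intro fundamental_theorem_of_calculus)
      (auto intro!: derivative_eq_intros simp: has_real_derivative_iff_has_vector_derivative[symmetric])
  then have tot: "integral {0..M} ?p = 1 - pois_less (K - s2) M"
    using assms by (simp add: integral_unique pois_less_at_0)
  have "integral {0..M} (\<lambda>s. ?p s * (1 - pois_less s2 (residual_beta2 a b s))) \<le> integral {0..M} ?p"
  proof (rule integral_le)
    show "(\<lambda>s. ?p s * (1 - pois_less s2 (residual_beta2 a b s))) integrable_on {0..M}"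
      by (intro integrable_continuous_real continuous_intros continuous_on_pois
          continuous_compose_UNIV[OF continuous_on_pois_less continuous_residual_beta2])
    show "?p integrable_on {0..M}"
      by (intro integrable_continuous_real continuous_on_pois)
    fix s assume "s \<in> {0..M}"
    then show "?p s * (1 - pois_less s2 (residual_beta2 a b s)) \<le> ?p s"
      using pois_less_nonneg[of "residual_beta2 a b s" s2] pois_nonneg[of s "K - s2 - 1"] ab
      by (auto simp: residual_beta2_def right_diff_distrib)
  qed
  also have "\<dots> \<le> 1"
    using tot pois_less_nonneg[of M "K - s2"] assms by simp
  finally show ?thesis
    by (simp add: z)
qed

lemma alpha_service_form_without_capacity:
  assumes "(S, a, b, 0) \<in> Z2 M"
  shows "alpha_service_form K s2 M (S, a, b, 0) = 0"
proof -
  have "residual_beta2 a b s = 0" "residual_alpha S a b 0 s = 0" for s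
    using assms by (auto simp: Z2_def residual_beta2_def residual_alpha_def)
  then show ?thesis
    by (simp add: lower_service_form_def capped_mean_at_0)
qed

lemma Theta_le_iff_certified:
  assumes s2: "1 \<le> s2" "s2 < K" and M: "M > 0" and z: "z \<in> Z2 M"
  shows "Theta K s2 M z \<le> \<theta> \<longleftrightarrow> certified K s2 M z \<theta>"
proof -
  obtain S a b \<Lambda> where zeq: "z = (S, a, b, \<Lambda>)" by (cases z)
  have \<Lambda>: "0 \<le> \<Lambda>"
    using z zeq by (auto simp: Z2_def)
  have "R1 K s2 M z \<le> \<theta> \<Longrightarrow> 0 \<le> \<theta>"
    using alive_form_nonneg[of s2 K M z] s2 M z by (simp add: R_eq_closed_form)
  moreover have "R3 K s2 M z = 0" if "\<Lambda> = 0"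
    using alpha_service_form_without_capacity[of S a b M K s2] that z zeq R_eq_closed_form(3)[OF s2 M z] by simp
  moreover have "0 < capped_mean K \<Lambda>" if "\<Lambda> \<noteq> 0"
    using that \<Lambda> s2 by (intro capped_mean_pos) auto
  ultimately have R3: "R1 K s2 M z \<le> \<theta> \<Longrightarrow>
      R3 K s2 M z / capped_mean K \<Lambda> \<le> \<theta> \<longleftrightarrow> R3 K s2 M z \<le> \<theta> * capped_mean K \<Lambda>"
    by (cases "\<Lambda> = 0") (auto simp: capped_mean_at_0 pos_divide_le_eq)
  have "Theta K s2 M z \<le> \<theta> \<longleftrightarrow>
      R1 K s2 M z \<le> \<theta> \<and> R2 K s2 M z / pois_less K \<Lambda> \<le> \<theta> \<and>
      R3 K s2 M z / capped_mean K \<Lambda> \<le> \<theta> \<and> R4 K s2 M z / capped_mean K M \<le> \<theta>"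
    unfolding Theta_def using s2 M \<Lambda>
    by (simp add: zeq P_eq_pois_less H_eq_capped_mean)
  also have "\<dots> \<longleftrightarrow> certified K s2 M z \<theta>"
    using R3 pois_less_pos[of K \<Lambda>] capped_mean_pos[of K M] s2 M \<Lambda> R_eq_closed_form[OF s2 M z]
    by (auto simp: zeq pos_divide_le_eq)
  finally show ?thesis .
qed

text \<open>The interval policy is extended to \<open>[0, 1]\<close> by shutting all rates down at time \<open>S/M\<close>, so that the
  upper clock stops at \<open>S\<close>.\<close>

lemma certified_is_feasible:
  assumes s2: "1 \<le> s2" "s2 < K" and M: "M > 0" and z: "z \<in> Z2 M" and cert: "certified K s2 M z \<theta>"
  shows "\<exists>\<alpha> \<beta>1 \<beta>2. feasible K s2 (\<lambda>_. M) \<theta> \<alpha> \<beta>1 \<beta>2"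
proof -
  obtain S a b \<Lambda> where zeq: "z = (S, a, b, \<Lambda>)" by (cases z)
  have z': "0 \<le> a" "a \<le> b" "b \<le> S" "S \<le> M" "b - a \<le> \<Lambda>" "\<Lambda> \<le> S"
    using z zeq by (auto simp: Z2_def)
  define \<beta>1 where "\<beta>1 = (\<lambda>t. M * indicator {0..S/M} t :: real)"
  have b1: "bdd_meas 1 \<beta>1"
    unfolding \<beta>1_def by (rule bdd_meas_scaled_indicator)
  obtain x where x: "is_solution K s2 1 \<beta>1 (beta2z M z) x"
    using solution_exists[OF s2(2) b1 bdd_meas_beta2z] by blast
  have T: "S / M \<le> 1"
    using z' M by simp
  note vals = interval_policy_values[OF s2 M zeq z T fun_cong[OF \<beta>1_def] x]
  have order: "0 \<le> beta2z M z t \<and> beta2z M z t \<le> alphaz M z t \<and> alphaz M z t \<le> \<beta>1 t \<and> \<beta>1 t \<le> M"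
    if t: "t \<in> {0..1}" for t
  proof -
    have 1: "t \<in> {(S - \<Lambda>)/M..S/M}" if "t \<in> {a/M..b/M}" "S - \<Lambda> \<le> a"
    proof -
      have "(S - \<Lambda>)/M \<le> a/M" "b/M \<le> S/M"
        using that z' M by (auto intro: divide_right_mono)
      then show ?thesis using that by auto
    qed
    have 2: "{a/M..b/M} \<subseteq> {0..S/M}" "{(S - \<Lambda>)/M..S/M} \<subseteq> {0..S/M}"
      "{(S - \<Lambda> + b - a)/M..S/M} \<subseteq> {0..S/M}"
      using z' M by (auto simp: field_simps intro: order_trans)
    show ?thesis
      unfolding zeq beta2z.simps alphaz.simps \<beta>1_def using 1 2 M
      by (auto simp: indicator_def)
  qed
  have meas: "alphaz M z \<in> borel_measurable (lebesgue_on {0..1})"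
    "\<beta>1 \<in> borel_measurable (lebesgue_on {0..1})"
    "beta2z M z \<in> borel_measurable (lebesgue_on {0..1})"
    using bdd_meas_alphaz[OF M, of 1 z] b1 bdd_meas_beta2z[of 1 M z]
    by (auto simp: bdd_meas_def)
  have lam: "(LINT t:{0..1::real}|lebesgue. M) = M"
    using bdd_meas_set_integral[OF bdd_meas_const[of 1 M], of 0 1] by simp
  have \<Lambda>0: "0 \<le> \<Lambda>" using z' by simp
  have "feasible K s2 (\<lambda>_. M) \<theta> (alphaz M z) \<beta>1 (beta2z M z)"
    unfolding feasible_def
    using cert order meas x s2 M \<Lambda>0
    by (intro conjI exI[of _ x] ballI)
      (simp_all only: vals lam P_eq_pois_less H_eq_capped_mean, auto simp: zeq P_eq_pois_less H_eq_capped_mean)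
  then show ?thesis by blast
qed

text \<open>The measurable rates are replaced by the dominating interval policy; the value for the full
  rate needs no inequality, as it depends only on \<open>\<sigma> 1\<close> and the service of the lower block.\<close>

lemma feasible_is_certified:
  assumes s2: "1 \<le> s2" "s2 < K" and M: "M > 0" and feas: "feasible K s2 (\<lambda>_. M) \<theta> \<alpha> \<beta>1 \<beta>2"
  shows "\<exists>z\<in>Z2 M. certified K s2 M z \<theta>"
proof -
  obtain x where x: "is_solution K s2 1 \<beta>1 \<beta>2 x"
    and c1: "(\<Sum>k=1..K. x k 1) \<le> \<theta>"
    and c2: "(\<Sum>k=s2+1..K. x k 1) \<le> \<theta> * P K (LINT t:{0..1}|lebesgue. \<alpha> t)"
    and c3: "(\<Sum>k=1..s2. LINT t:{0..1}|lebesgue. \<beta>2 t * x k t) +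
          (\<Sum>k=s2+1..K. LINT t:{0..1}|lebesgue. \<alpha> t * x k t)
        \<le> \<theta> * H K (LINT t:{0..1}|lebesgue. \<alpha> t)"
    and c4: "(\<Sum>k=1..s2. LINT t:{0..1}|lebesgue. \<beta>2 t * x k t) +
          (\<Sum>k=s2+1..K. LINT t:{0..1}|lebesgue. \<beta>1 t * x k t)
        \<le> \<theta> * H K (LINT t:{0..1::real}|lebesgue. M)"
    using feas unfolding feasible_def by blast
  have order: "0 \<le> \<beta>2 t \<and> \<beta>2 t \<le> \<alpha> t \<and> \<alpha> t \<le> \<beta>1 t \<and> \<beta>1 t \<le> M" if "t \<in> {0..1}" for t
    using feas that unfolding feasible_def by blast
  have bm: "bdd_meas 1 \<alpha>" "bdd_meas 1 \<beta>1" "bdd_meas 1 \<beta>2"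
    using feas order unfolding feasible_def
    by (auto intro!: bdd_measI[where C = M]) (force dest: order)+
  interpret A: controlled_chain K s2 1 \<beta>1 \<beta>2 \<alpha> x
    using s2 bm x by unfold_locales auto
  interpret B: controlled_chain K s2 1 \<beta>1 \<beta>2 \<beta>1 x
    using s2 bm x by unfold_locales auto
  have lam: "(LINT t:{0..1::real}|lebesgue. M) = M"
    using bdd_meas_set_integral[OF bdd_meas_const[of 1 M], of 0 1] by simp
  have \<alpha>D: "(LINT t:{0..1}|lebesgue. \<alpha> t) = A.D 0"
    using bdd_meas_set_integral[OF bm(1), of 0 1] by (simp add: A.D_def)
  have \<sigma>M: "A.\<sigma> 1 \<le> M"
  proof -
    have "integral {0..1} \<beta>1 \<le> integral {0..1} (\<lambda>_::real. M)"
      by (rule integral_le[OF bdd_meas_integrable[OF bm(2)]]) (use order in auto)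
    then show ?thesis by (simp add: A.\<sigma>_def)
  qed
  obtain a b where Z: "(A.\<sigma> 1, a, b, A.D 0) \<in> Z2 M"
    and J: "integral {0..1} (\<lambda>t. A.entry t * capped_mean s2 (A.G t)) = lower_service_form K s2 M a b"
    and f1: "alive_form K s2 M (A.\<sigma> 1, a, b, A.D 0) \<le> (\<Sum>k=1..K. x k 1)"
    and f3: "alpha_service_form K s2 M (A.\<sigma> 1, a, b, A.D 0) \<le> integral {0..1} (\<lambda>t. A.entry t * capped_mean s2 (A.G t))
         + A.D 0 - integral {0..1} (\<lambda>t. A.entry t * A.D t)"
    using A.interval_policy_dominates[OF _ \<sigma>M] order by blast
  have \<Lambda>: "0 \<le> A.D 0"
    using Z by (auto simp: Z2_def)
  have f2: "upper_form K s2 (A.\<sigma> 1, a, b, A.D 0) = (\<Sum>k=s2+1..K. x k 1)"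
    using A.upper_sum[of 1] by simp
  have BD: "B.D t = A.\<sigma> 1 - A.\<sigma> t" if "t \<in> {0..1}" for t
    using primitive_increment[OF A.primitive_\<sigma>, of t 1] that by (simp add: B.D_def)
  have nonneg: "0 \<le> \<beta>1 t" if "t \<in> {0..1}" for t
    using order[OF that] by linarith
  have \<sigma>_le: "A.\<sigma> t \<le> A.\<sigma> 1" if "t \<in> {0..1}" for t
  proof -
    have "0 - 0 \<le> A.\<sigma> 1 - A.\<sigma> t"
      by (rule primitive_mono[OF primitive_const[of 1 0] A.primitive_\<sigma>]) (use that nonneg in auto)
    then show ?thesis by simp
  qed
  have "integral {0..1} (\<lambda>t. B.entry t * B.D t)
      = integral {0..1} (\<lambda>t. B.entry t * max 0 (A.\<sigma> 1 - A.\<sigma> t))"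
    using BD \<sigma>_le by (intro Henstock_Kurzweil_Integration.integral_cong) auto
  also have "\<dots> = integral {0..M} (\<lambda>s. pois (K - s2 - 1) s * max 0 (A.\<sigma> 1 - s))"
    by (rule B.entry_integral) (use \<sigma>M nonneg in \<open>auto intro!: continuous_intros\<close>)
  finally have f4: "full_service_form K s2 M (A.\<sigma> 1, a, b, A.D 0) = integral {0..1} (\<lambda>t. B.entry t * capped_mean s2 (B.G t))
         + B.D 0 - integral {0..1} (\<lambda>t. B.entry t * B.D t)"
    using BD[of 0] J by (simp add: A.\<sigma>_0)
  have "certified K s2 M (A.\<sigma> 1, a, b, A.D 0) \<theta>"
    using c1 c2 c3 c4 f1 f2 f3 f4 s2 M \<Lambda>
    unfolding A.service_eq B.service_eq \<alpha>D lam certified.simps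
    by (simp add: P_eq_pois_less H_eq_capped_mean)
  then show ?thesis
    using Z by blast
qed

lemma certified_compact:
  "compact {(z, \<theta>). z \<in> Z2 M \<and> 0 \<le> \<theta> \<and> \<theta> \<le> C \<and> certified K s2 M z \<theta>}"
proof -
  let ?S = "\<lambda>p::params \<times> real. fst (fst p)" and ?a = "\<lambda>p::params \<times> real. fst (snd (fst p))"
    and ?b = "\<lambda>p::params \<times> real. fst (snd (snd (fst p)))"
    and ?L = "\<lambda>p::params \<times> real. snd (snd (snd (fst p)))"
  let ?X = "{p. 0 \<le> ?a p \<and> ?a p \<le> ?b p \<and> ?b p \<le> ?S p \<and> ?S p \<le> M \<and>
     ?b p - ?a p \<le> ?L p \<and> ?L p \<le> ?S p \<and>
     alive_form K s2 M (fst p) \<le> snd p \<and> upper_form K s2 (fst p) \<le> snd p * pois_less K (?L p) \<and>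
     alpha_service_form K s2 M (fst p) \<le> snd p * capped_mean K (?L p) \<and> full_service_form K s2 M (fst p) \<le> snd p * capped_mean K M}"
  let ?box = "({0..M} \<times> {0..M} \<times> {0..M} \<times> {0..M}) \<times> {0..C}"
  have "closed ?X"
    by (intro closed_Collect_conj closed_Collect_le continuous_intros
        continuous_compose_UNIV[OF continuous_closed_forms(1)] continuous_compose_UNIV[OF continuous_closed_forms(2)]
        continuous_compose_UNIV[OF continuous_closed_forms(3)] continuous_compose_UNIV[OF continuous_closed_forms(4)]
        continuous_compose_UNIV[OF continuous_on_pois_less] continuous_compose_UNIV[OF continuous_on_capped_mean])
  moreover have "compact ?box"
    by (intro compact_Times compact_Icc)
  ultimately have "compact (?box \<inter> ?X)"
    by (rule compact_Int_closed[rotated])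
  moreover have "{(z, \<theta>). z \<in> Z2 M \<and> 0 \<le> \<theta> \<and> \<theta> \<le> C \<and> certified K s2 M z \<theta>} = ?box \<inter> ?X"
    by (auto simp: Z2_def)
  ultimately show ?thesis by simp
qed

theorem theorem3:
  fixes K s2 :: nat and M :: real
  assumes "K \<ge> 2" and "M > 0" and "s2 \<in> {1..K - 1}"
  shows "\<exists>z\<in>Z2 M. (\<forall>z'\<in>Z2 M. Theta K s2 M z \<le> Theta K s2 M z') \<and>
           PoisOPTRe K s2 (\<lambda>_. M) = ereal (Theta K s2 M z)"
proof -
  have s2: "1 \<le> s2" "s2 < K" and M: "M > 0"
    using assms by auto
  note cert = Theta_le_iff_certified[OF s2 M]
  have pos: "0 \<le> \<theta>" if "z \<in> Z2 M" "certified K s2 M z \<theta>" for z \<theta>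
    using that alive_form_nonneg[of s2 K M z] s2 M by (cases z) auto
  \<comment> \<open>The minimum does not exceed the value at one fixed parameter, so \<open>\<theta>\<close> may be confined to \<open>[0, C]\<close>.\<close>
  define C where "C = Theta K s2 M (0, 0, 0, 0)"
  define E where "E = {(z, \<theta>). z \<in> Z2 M \<and> 0 \<le> \<theta> \<and> \<theta> \<le> C \<and> certified K s2 M z \<theta>}"
  have Theta_E: "(z, Theta K s2 M z) \<in> E" if "z \<in> Z2 M" "Theta K s2 M z \<le> C" for z
    using cert[OF that(1)] pos that unfolding E_def by blast
  have "(0, 0, 0, 0) \<in> Z2 M"
    using M by (simp add: Z2_def)
  then have "E \<noteq> {}"
    using Theta_E unfolding C_def by blast
  moreover have "compact E"
    unfolding E_def by (rule certified_compact)
  ultimately obtain p where p: "p \<in> E" "\<And>q. q \<in> E \<Longrightarrow> snd p \<le> snd q"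
    using continuous_attains_inf[of E snd] continuous_on_snd[OF continuous_on_id, of E] by blast
  obtain z \<theta> where zp: "p = (z, \<theta>)" by (cases p)
  have z: "z \<in> Z2 M" "\<theta> \<le> C" "Theta K s2 M z \<le> \<theta>"
    using p(1) cert unfolding E_def zp by auto
  have opt: "Theta K s2 M z \<le> Theta K s2 M z'" if "z' \<in> Z2 M" for z'
    using p(2)[OF Theta_E[OF that]] z zp by (cases "Theta K s2 M z' \<le> C") auto
  have "PoisOPTRe K s2 (\<lambda>_. M) = ereal (Theta K s2 M z)"
    unfolding PoisOPTRe_def
  proof (rule antisym)
    have "certified K s2 M z (Theta K s2 M z)"
      using cert[OF z(1)] by blast
    then show "Inf {ereal \<theta> |\<theta>. \<exists>\<alpha> \<beta>1 \<beta>2. feasible K s2 (\<lambda>_. M) \<theta> \<alpha> \<beta>1 \<beta>2} \<le> ereal (Theta K s2 M z)"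
      using certified_is_feasible[OF s2 M z(1)] by (intro Inf_lower) auto
    show "ereal (Theta K s2 M z) \<le> Inf {ereal \<theta> |\<theta>. \<exists>\<alpha> \<beta>1 \<beta>2. feasible K s2 (\<lambda>_. M) \<theta> \<alpha> \<beta>1 \<beta>2}"
    proof (rule Inf_greatest, clarify)
      fix \<theta> \<alpha> \<beta>1 \<beta>2 assume "feasible K s2 (\<lambda>_. M) \<theta> \<alpha> \<beta>1 \<beta>2"
      then obtain z' where "z' \<in> Z2 M" "certified K s2 M z' \<theta>"
        using feasible_is_certified[OF s2 M] by blast
      then show "ereal (Theta K s2 M z) \<le> ereal \<theta>"
        using opt[of z'] cert[of z' \<theta>] by simp
    qed
  qed
  then show ?thesis
    using z opt by blast
qed

end
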